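(* Let $T=-T_{\mathfrak p}Q|_{\mathfrak p}+T_1Q|_{\mathfrak k_1}+\cdots+T_{r+s}Q|_{\mathfrak k_{r+s}}$ be a left-invariant $(0,2)$-tensor field on $G$ with $T_{\mathfrak p},T_1,\dots,T_{r+s}>0$. Choose an index $m\in\{1,\dots,r\}$ with $\frac{\kappa_m}{T_m}=\max_{i=1,\dots,r}\frac{\kappa_i}{T_i}$. If $$\frac{\kappa_m\,\mathrm{tr}_QT}{T_m}<\dim\mathfrak k+d_m(1-\kappa_m)-3n$$ and $$\sum_{i=1}^{r+s}\frac{n^2\kappa_iT_{\mathfrak p}^2-d_i^2(1-\kappa_i)T_i^2}{nT_{\mathfrak p}T_i}-2n<0,$$ then the functional $S|_{\mathcal M_T^+}$ attains its global maximum.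
   Context: Let $G$ be a connected non-compact simple Lie group with Lie algebra $\mathfrak g$, $K$ a maximal compact subgroup with Lie algebra $\mathfrak k$, $B$ the Killing form of $\mathfrak g$, and $\mathfrak p$ the $B$-orthogonal complement of $\mathfrak k$ in $\mathfrak g$. Let $Q=B|_{\mathfrak p}-B|_{\mathfrak k}$ (an inner product on $\mathfrak g$; $\mathrm{tr}_QT$ is the trace of $T$ with respect to $Q$, i.e. $-nT_{\mathfrak p}+\sum_id_iT_i$). Write $\mathfrak k=\mathfrak k_1\oplus\cdots\oplus\mathfrak k_{r+s}$, where $\mathfrak k_1,\dots,\mathfrak k_r$ are the simple ideals of $[\mathfrak k,\mathfrak k]$, $\mathfrak k_{r+1}$ is the centre of $\mathfrak k$, and $s=1$ if the centre is nontrivial, $s=0$ otherwise. Let $n=\dim\mathfrak p$, $d_i=\dim\mathfrak k_i$, and define $\kappa_i$ by $B_i=\kappa_iB|_{\mathfrak k_i}$, $B_i$ the Killing form of $\mathfrak k_i$. Left-invariant tensor fields on $G$ are identified with bilinear forms on $\mathfrak g$; $Q|_{\mathfrak u}$ denotes $Q$ restricted to $\mathfrak u$ and extended by zero on its $Q$-orthogonal complement. $\mathcal M_K$ is the set of left-invariant metrics on $G$ naturally reductive with respect to $G\times K$ (acting by $(x,k)y=xyk^{-1}$), which by a theorem of Gordon are exactly the metrics $\beta Q|_{\mathfrak p}+\sum_i\alpha_iQ|_{\mathfrak k_i}$ with $\beta,\alpha_i>0$. $S$ is the scalar curvature functional on $\mathcal M_K$, and $\mathcal M_T^+=\{g\in\mathcal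 M_K:\mathrm{tr}_gT=1\}$. *)

theory Defs
  imports "HOL-Analysis.Analysis"
begin

text \<open>Real finite-dimensional Lie algebras are modelled on a type of class euclidean_space
  (only its real vector space structure is used), with a bracket br.\<close>

definition lie_bracket :: "('g::euclidean_space \<Rightarrow> 'g \<Rightarrow> 'g) \<Rightarrow> bool" where
  "lie_bracket br \<longleftrightarrow> (\<forall>X. linear (br X)) \<and> (\<forall>Y. linear (\<lambda>X. br X Y))
     \<and> (\<forall>X Y. br X Y = - br Y X)
     \<and> (\<forall>X Y Z. br X (br Y Z) + br Y (br Z X) + br Z (br X Y) = 0)"

definition subalgebra :: "('g::euclidean_space \<Rightarrow> 'g \<Rightarrow> 'g) \<Rightarrow> 'g set \<Rightarrow> bool" where
  "subalgebra br h \<longleftrightarrow> subspace h \<and> (\<forall>X\<in>h. \<forall>Y\<in>h. br X Y \<in> h)"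

definition ideal_in :: "('g::euclidean_space \<Rightarrow> 'g \<Rightarrow> 'g) \<Rightarrow> 'g set \<Rightarrow> 'g set \<Rightarrow> bool" where
  "ideal_in br h a \<longleftrightarrow> subspace h \<and> h \<subseteq> a \<and> (\<forall>X\<in>a. \<forall>Y\<in>h. br X Y \<in> h)"

definition simple_alg :: "('g::euclidean_space \<Rightarrow> 'g \<Rightarrow> 'g) \<Rightarrow> 'g set \<Rightarrow> bool" where
  "simple_alg br a \<longleftrightarrow> subalgebra br a \<and> (\<exists>X\<in>a. \<exists>Y\<in>a. br X Y \<noteq> 0)
     \<and> (\<forall>h. ideal_in br h a \<longrightarrow> h = {0} \<or> h = a)"

definition derived :: "('g::euclidean_space \<Rightarrow> 'g \<Rightarrow> 'g) \<Rightarrow> 'g set \<Rightarrow> 'g set" where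
  "derived br a = span {br X Y | X Y. X \<in> a \<and> Y \<in> a}"

definition centre :: "('g::euclidean_space \<Rightarrow> 'g \<Rightarrow> 'g) \<Rightarrow> 'g set \<Rightarrow> 'g set" where
  "centre br a = {X \<in> a. \<forall>Y\<in>a. br X Y = 0}"

text \<open>Trace of a linear map f restricted to an invariant subspace V (basis independent).\<close>
definition trace_on :: "'g::euclidean_space set \<Rightarrow> ('g \<Rightarrow> 'g) \<Rightarrow> real" where
  "trace_on V f = (let Bv = (SOME Bv. independent Bv \<and> span Bv = V)
                   in \<Sum>b\<in>Bv. representation Bv (f b) b)"

definition killing_on :: "('g::euclidean_space \<Rightarrow> 'g \<Rightarrow> 'g) \<Rightarrow> 'g set \<Rightarrow> 'g \<Rightarrow> 'g \<Rightarrow> real" where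
  "killing_on br a X Y = trace_on a (\<lambda>Z. br X (br Y Z))"

definition killing :: "('g::euclidean_space \<Rightarrow> 'g \<Rightarrow> 'g) \<Rightarrow> 'g \<Rightarrow> 'g \<Rightarrow> real" where
  "killing br = killing_on br UNIV"

definition cartan_involution :: "('g::euclidean_space \<Rightarrow> 'g \<Rightarrow> 'g) \<Rightarrow> ('g \<Rightarrow> 'g) \<Rightarrow> bool" where
  "cartan_involution br \<theta> \<longleftrightarrow> linear \<theta> \<and> (\<forall>X. \<theta> (\<theta> X) = X)
     \<and> (\<forall>X Y. \<theta> (br X Y) = br (\<theta> X) (\<theta> Y))
     \<and> (\<forall>X. X \<noteq> 0 \<longrightarrow> killing br X (\<theta> X) < 0)"

text \<open>k = Lie algebra of K (fixed points of the Cartan involution), p = its B-orthogonal complement\<close>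
definition kspace :: "('g::euclidean_space \<Rightarrow> 'g) \<Rightarrow> 'g set" where
  "kspace \<theta> = {X. \<theta> X = X}"

definition pspace :: "('g::euclidean_space \<Rightarrow> 'g \<Rightarrow> 'g) \<Rightarrow> ('g \<Rightarrow> 'g) \<Rightarrow> 'g set" where
  "pspace br \<theta> = {X. \<forall>Y\<in>kspace \<theta>. killing br X Y = 0}"

definition kproj :: "('g::euclidean_space \<Rightarrow> 'g) \<Rightarrow> 'g \<Rightarrow> 'g" where
  "kproj \<theta> X = (1/2) *\<^sub>R (X + \<theta> X)"

definition pproj :: "('g::euclidean_space \<Rightarrow> 'g) \<Rightarrow> 'g \<Rightarrow> 'g" where
  "pproj \<theta> X = (1/2) *\<^sub>R (X - \<theta> X)"

definition Qform :: "('g::euclidean_space \<Rightarrow> 'g \<Rightarrow> 'g) \<Rightarrow> ('g \<Rightarrow> 'g) \<Rightarrow> 'g \<Rightarrow> 'g \<Rightarrow> real" where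
  "Qform br \<theta> X Y = killing br (pproj \<theta> X) (pproj \<theta> Y) - killing br (kproj \<theta> X) (kproj \<theta> Y)"

definition qproj :: "('g::euclidean_space \<Rightarrow> 'g \<Rightarrow> real) \<Rightarrow> 'g set \<Rightarrow> 'g \<Rightarrow> 'g" where
  "qproj q u X = (THE y. y \<in> u \<and> (\<forall>z\<in>u. q (X - y) z = 0))"

definition Qres :: "('g::euclidean_space \<Rightarrow> 'g \<Rightarrow> real) \<Rightarrow> 'g set \<Rightarrow> 'g \<Rightarrow> 'g \<Rightarrow> real" where
  "Qres q u X Y = q (qproj q u X) (qproj q u Y)"

definition onb :: "('g::euclidean_space \<Rightarrow> 'g \<Rightarrow> real) \<Rightarrow> 'g set \<Rightarrow> bool" where
  "onb g E \<longleftrightarrow> finite E \<and> span E = UNIV \<and> (\<forall>e\<in>E. g e e = 1)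
     \<and> (\<forall>e\<in>E. \<forall>e'\<in>E. e \<noteq> e' \<longrightarrow> g e e' = 0)"

definition tr_form :: "('g::euclidean_space \<Rightarrow> 'g \<Rightarrow> real) \<Rightarrow> ('g \<Rightarrow> 'g \<Rightarrow> real) \<Rightarrow> real" where
  "tr_form g T = (SOME t. \<exists>E. onb g E \<and> t = (\<Sum>e\<in>E. T e e))"

text \<open>Levi-Civita connection of the left-invariant metric g (Koszul formula on left-invariant
  fields), curvature, Ricci and scalar curvature.\<close>
definition lc_conn :: "('g::euclidean_space \<Rightarrow> 'g \<Rightarrow> 'g) \<Rightarrow> ('g \<Rightarrow> 'g \<Rightarrow> real) \<Rightarrow> 'g \<Rightarrow> 'g \<Rightarrow> 'g" where
  "lc_conn br g X Y = (THE W. \<forall>Z. g W Z = (g (br X Y) Z - g (br Y Z) X + g (br Z X) Y) / 2)"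

definition curv :: "('g::euclidean_space \<Rightarrow> 'g \<Rightarrow> 'g) \<Rightarrow> ('g \<Rightarrow> 'g \<Rightarrow> real) \<Rightarrow> 'g \<Rightarrow> 'g \<Rightarrow> 'g \<Rightarrow> 'g" where
  "curv br g X Y Z = lc_conn br g X (lc_conn br g Y Z) - lc_conn br g Y (lc_conn br g X Z)
                     - lc_conn br g (br X Y) Z"

definition ricci :: "('g::euclidean_space \<Rightarrow> 'g \<Rightarrow> 'g) \<Rightarrow> ('g \<Rightarrow> 'g \<Rightarrow> real) \<Rightarrow> 'g \<Rightarrow> 'g \<Rightarrow> real" where
  "ricci br g Y Z = trace_on UNIV (\<lambda>X. curv br g X Y Z)"

definition scal :: "('g::euclidean_space \<Rightarrow> 'g \<Rightarrow> 'g) \<Rightarrow> ('g \<Rightarrow> 'g \<Rightarrow> real) \<Rightarrow> real" where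
  "scal br g = tr_form g (ricci br g)"

text \<open>M_K (Gordon's description): beta Q|p + sum alpha_i Q|k_i with beta, alpha_i > 0;
  N = r + s is the number of summands of k.\<close>
definition MK :: "('g::euclidean_space \<Rightarrow> 'g \<Rightarrow> 'g) \<Rightarrow> ('g \<Rightarrow> 'g) \<Rightarrow> (nat \<Rightarrow> 'g set) \<Rightarrow> nat
                   \<Rightarrow> ('g \<Rightarrow> 'g \<Rightarrow> real) set" where
  "MK br \<theta> kk N = {g. \<exists>\<beta> \<alpha>. \<beta> > 0 \<and> (\<forall>i\<in>{1..N}. \<alpha> i > 0) \<and>
      g = (\<lambda>X Y. \<beta> * Qres (Qform br \<theta>) (pspace br \<theta>) X Y
                 + (\<Sum>i\<in>{1..N}. \<alpha> i * Qres (Qform br \<theta>) (kk i) X Y))}"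

end

theory Submission
  imports Defs
begin

text \<open>Both the scalar curvature and the trace constraint depend only on the eigenvalues
  \<open>\<beta>, \<alpha>\<^sub>i\<close> of the metric. In the coordinates \<open>x\<^sub>i = 1/\<alpha>\<^sub>i\<close>, \<open>y = 1/\<beta>\<close> the constraint reads
  \<open>\<Sum> d\<^sub>i T\<^sub>i x\<^sub>i = 1 + n T\<^sub>p y\<close> and
  \<open>4 S = \<Sum> (d\<^sub>i \<kappa>\<^sub>i x\<^sub>i - d\<^sub>i (1 - \<kappa>\<^sub>i) y\<^sup>2 / x\<^sub>i) - 2 n y\<close>. Put \<open>L = \<kappa>\<^sub>m / T\<^sub>m\<close>.
  As \<open>y\<close> tends to 0, the limit superior of \<open>4 S\<close> is at most \<open>L\<close>, but along \<open>x\<^sub>i = y\<close> (\<open>i \<noteq> m\<close>) the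
  first-order term in \<open>y\<close> is positive by the first hypothesis together with
  \<open>n = 2 \<Sum> d\<^sub>i (1 - \<kappa>\<^sub>i)\<close>, so \<open>4 S > L\<close> somewhere. The second hypothesis makes \<open>S\<close> negative for large
  \<open>y\<close>, and with \<open>y\<close> bounded away from 0 the negative terms (\<open>\<kappa>\<^sub>i < 1\<close> because \<open>g\<close> is simple and
  non-compact) keep each \<open>x\<^sub>i\<close> away from 0. Hence a superlevel set of \<open>S\<close> is compact.\<close>

section \<open>Symmetric positive definite forms\<close>

text \<open>The feasible set is not compact, so compactness must come from the functional, and each
  hypothesis guards one end. As \<open>y\<close> tends to 0 the constraint becomes a simplex in the
  variables \<open>w i * x i\<close>, on which the positive part of the functional is linear with
  values \<open>\<kappa> i / T i\<close> at the vertices; this is where \<open>L\<close> comes from.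
  A maximising sequence could still escape to that face unless some genuine metric beats
  \<open>L\<close>. For large \<open>y\<close> the functional is compared with a linear one: letting
  every \<open>w i * x i\<close> take the whole right-hand side of the constraint at once bounds the
  rate of growth, and the left side of the second hypothesis is the limit of this bound. The
  identity for \<open>n\<close> and the curvature formula have a common source. The squared
  structure constants, summed over blocks, survive only for three indices in one summand of k, or
  for one such index and two in p. Their values follow by splitting the trace that defines
  \<open>B\<close> on a summand of k into its part over that summand, which gives
  \<open>\<kappa> i\<close>, and its part over p, which gives \<open>1 - \<kappa> i\<close>.\<close>

lemma bilinear_sum_both:
  assumes "bilinear h"
  shows "h (\<Sum>i\<in>A. f i) y = (\<Sum>i\<in>A. h (f i) y)" "h x (\<Sum>i\<in>A. f i) = (\<Sum>i\<in>A. h x (f i))"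
  using assms linear_sum[of "\<lambda>x. h x y" f A] linear_sum[of "h x" f A]
  by (auto simp: bilinear_def)

locale inner_form =
  fixes q :: "'g::euclidean_space \<Rightarrow> 'g \<Rightarrow> real"
  assumes bil: "bilinear q"
    and sym: "q x y = q y x"
    and pos: "x \<noteq> 0 \<Longrightarrow> 0 < q x x"
begin

lemmas q_simps =
  bilinear_ladd[OF bil] bilinear_radd[OF bil] bilinear_lmul[OF bil] bilinear_rmul[OF bil]
  bilinear_lneg[OF bil] bilinear_rneg[OF bil] bilinear_lsub[OF bil] bilinear_rsub[OF bil]
  bilinear_lzero[OF bil] bilinear_rzero[OF bil] bilinear_sum_both[OF bil]

lemma q_nonneg: "0 \<le> q x x"
  using pos[of x] q_simps(9)[of 0] by (cases "x = 0") auto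

lemma q_eq_0_iff: "q x x = 0 \<longleftrightarrow> x = 0"
  using pos[of x] q_simps(9)[of 0] by (cases "x = 0") auto

lemma q_eqI: "(\<And>z. q x z = q y z) \<Longrightarrow> x = y"
  using q_eq_0_iff[of "x - y"] by (simp add: q_simps)

text \<open>A version of \<open>onb\<close> relative to a subspace: traces over single summands and
  the projections inside \<open>Qres\<close> need bases of proper subspaces.\<close>

definition onb_on :: "'g set \<Rightarrow> 'g set \<Rightarrow> bool" where
  "onb_on V E \<longleftrightarrow> finite E \<and> span E = V \<and> (\<forall>e\<in>E. q e e = 1)
     \<and> (\<forall>e\<in>E. \<forall>e'\<in>E. e \<noteq> e' \<longrightarrow> q e e' = 0)"

lemma onb_UNIV_iff: "onb q E \<longleftrightarrow> onb_on UNIV E"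
  by (simp add: onb_def onb_on_def)

lemma onb_on_finite: "onb_on V E \<Longrightarrow> finite E"
  and onb_on_span: "onb_on V E \<Longrightarrow> span E = V"
  and onb_on_unit: "onb_on V E \<Longrightarrow> e \<in> E \<Longrightarrow> q e e = 1"
  and onb_on_orth: "onb_on V E \<Longrightarrow> e \<in> E \<Longrightarrow> f \<in> E \<Longrightarrow> e \<noteq> f \<Longrightarrow> q e f = 0"
  by (auto simp: onb_on_def)

lemma onb_on_mem: "onb_on V E \<Longrightarrow> e \<in> E \<Longrightarrow> e \<in> V"
  using onb_on_span span_base by metis

lemma onb_on_delta:
  assumes "onb_on V E" "e \<in> E" "f \<in> E"
  shows "q e f = (if e = f then 1 else 0)"
  using assms by (auto simp: onb_on_def)

lemma q_sum_onb:
  assumes E: "onb_on V E" and f: "f \<in> E"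
  shows "q (\<Sum>e\<in>E. c e *\<^sub>R e) f = c f"
proof -
  have "q (\<Sum>e\<in>E. c e *\<^sub>R e) f = (\<Sum>e\<in>E. c e * (if e = f then 1 else 0))"
    using onb_on_delta[OF E _ f] by (simp add: q_simps cong: sum.cong)
  also have "\<dots> = c f"
    using f onb_on_finite[OF E] by (simp add: if_distrib sum.delta cong: if_cong)
  finally show ?thesis .
qed

lemma onb_expand:
  assumes E: "onb_on V E" and x: "x \<in> V"
  shows "x = (\<Sum>e\<in>E. q x e *\<^sub>R e)"
proof -
  have "x \<in> span E" using E x by (simp add: onb_on_def)
  then obtain c where c: "x = (\<Sum>e\<in>E. c e *\<^sub>R e)"
    using onb_on_finite[OF E] by (auto simp: span_finite)
  have "q x e = c e" if "e \<in> E" for e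
    unfolding c by (rule q_sum_onb[OF E that])
  then show ?thesis by (subst c) (auto intro: sum.cong)
qed

lemma onb_parseval:
  assumes E: "onb_on V E" and x: "x \<in> V"
  shows "q x y = (\<Sum>e\<in>E. q x e * q y e)"
proof -
  have "q x y = q (\<Sum>e\<in>E. q x e *\<^sub>R e) y" using onb_expand[OF E x] by simp
  also have "\<dots> = (\<Sum>e\<in>E. q x e * q y e)" by (simp add: q_simps sym)
  finally show ?thesis .
qed

lemma onb_on_independent:
  assumes E: "onb_on V E" shows "independent E"
proof (rule independent_if_scalars_zero[OF onb_on_finite[OF E]])
  fix c x assume "(\<Sum>e\<in>E. c e *\<^sub>R e) = 0" "x \<in> E"
  then show "c x = 0" using q_sum_onb[OF E, of x c] by (simp add: q_simps)
qed

lemma onb_on_card: "onb_on V E \<Longrightarrow> card E = dim V"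
  using onb_on_independent onb_on_span dim_span_eq_card_independent by metis

text \<open>One Gram-Schmidt step per vector: the remainder \<open>v\<close> of \<open>b\<close> is
  orthogonal to the basis found so far, and is either zero, so that the span does not grow, or is
  normalised and added.\<close>

lemma exists_onb_on_span:
  assumes "finite B" shows "\<exists>E. onb_on (span B) E"
  using assms
proof (induction B rule: finite_induct)
  case empty
  have "onb_on (span {}) {}" by (simp add: onb_on_def)
  then show ?case by blast
next
  case (insert b B)
  then obtain E where E: "onb_on (span B) E" by blast
  define v where "v = b - (\<Sum>e\<in>E. q b e *\<^sub>R e)"
  have vE: "q v e = 0" if "e \<in> E" for e
    using q_sum_onb[OF E that, of "q b"] by (simp add: v_def q_simps)
  have sE: "(\<Sum>e\<in>E. q b e *\<^sub>R e) \<in> span B"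
    using onb_on_mem[OF E] by (intro span_sum span_scale) auto
  show ?case
  proof (cases "v = 0")
    case True
    then have "b \<in> span B" using sE by (simp add: v_def)
    then have "span (insert b B) = span B" by (rule span_redundant)
    then show ?thesis using E by auto
  next
    case False
    define w where "w = (1 / sqrt (q v v)) *\<^sub>R v"
    have vv: "q v v > 0" using False pos by simp
    have ww: "q w w = 1" using vv by (simp add: w_def q_simps field_simps)
    have wE: "q w e = 0" "q e w = 0" if "e \<in> E" for e
      using vE[OF that] sym[of w e] by (simp_all add: w_def q_simps)
    have "span (insert w E) = span (insert b B)"
    proof
      have EB: "span E = span B" using E by (rule onb_on_span)
      have "b \<in> span (insert b B)" "(\<Sum>e\<in>E. q b e *\<^sub>R e) \<in> span (insert b B)"
        using sE span_mono[of B "insert b B"] by (auto intro: span_base)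
      then have "w \<in> span (insert b B)"
        unfolding w_def v_def by (intro span_scale span_diff)
      moreover have "E \<subseteq> span (insert b B)"
        using EB span_superset[of E] span_mono[of B "insert b B"] by auto
      ultimately show "span (insert w E) \<subseteq> span (insert b B)"
        by (intro span_minimal) auto
      have "b = sqrt (q v v) *\<^sub>R w + (\<Sum>e\<in>E. q b e *\<^sub>R e)"
        using vv by (simp add: w_def v_def)
      also have "\<dots> \<in> span (insert w E)"
        by (intro span_add span_scale span_sum span_base) auto
      finally have "b \<in> span (insert w E)" .
      moreover have "B \<subseteq> span (insert w E)"
        using EB span_superset[of B] span_mono[of E "insert w E"] by auto
      ultimately show "span (insert b B) \<subseteq> span (insert w E)"
        by (intro span_minimal) auto
    qed
    then have "onb_on (span (insert b B)) (insert w E)"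
      using E ww wE by (auto simp: onb_on_def)
    then show ?thesis by blast
  qed
qed

lemma exists_onb_on:
  assumes "subspace V" shows "\<exists>E. onb_on V E"
proof -
  obtain B where B: "B \<subseteq> V" "independent B" "V \<subseteq> span B" by (rule basis_exists)
  then have "span B = V" using assms by (simp add: span_minimal subset_antisym)
  moreover have "finite B" using B(2) by (rule independent_imp_finite)
  ultimately show ?thesis using exists_onb_on_span by metis
qed

text \<open>\<open>trace_on\<close> picks an arbitrary basis. Expanding its members in
  \<open>E\<close> and exchanging the two sums removes the choice; invariance of \<open>V\<close>
  keeps the images inside the span, where coordinates are meaningful.\<close>

lemma trace_on_eq:
  assumes E: "onb_on V E" and f: "linear f" and fV: "\<And>x. x \<in> V \<Longrightarrow> f x \<in> V"
  shows "trace_on V f = (\<Sum>e\<in>E. q (f e) e)"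
proof -
  define B where "B = (SOME Bv. independent Bv \<and> span Bv = V)"
  have "independent B \<and> span B = V"
    unfolding B_def by (rule someI_ex) (use onb_on_independent[OF E] onb_on_span[OF E] in blast)
  then have B: "independent B" "span B = V" by auto
  have fin: "finite B" using B independent_imp_finite by blast
  have BV: "b \<in> V" if "b \<in> B" for b using that B span_base by blast
  have rep: "representation B (f b) b = (\<Sum>e\<in>E. q b e * representation B (f e) b)"
    if "b \<in> B" for b
  proof -
    have "f b = f (\<Sum>e\<in>E. q b e *\<^sub>R e)"
      using onb_expand[OF E BV[OF that]] by simp
    then have "f b = (\<Sum>e\<in>E. q b e *\<^sub>R f e)"
      by (simp add: linear_sum[OF f] linear_scale[OF f])
    moreover have fe: "f e \<in> span B" if "e \<in> E" for e
      using onb_on_mem[OF E that] fV B by auto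
    ultimately show ?thesis
      using representation_sum[OF B(1), of E "\<lambda>e. q b e *\<^sub>R f e", OF span_scale[OF fe]]
      by (simp add: representation_scale[OF B(1) fe])
  qed
  have "trace_on V f = (\<Sum>b\<in>B. representation B (f b) b)"
    by (simp add: trace_on_def B_def Let_def)
  also have "\<dots> = (\<Sum>b\<in>B. \<Sum>e\<in>E. q b e * representation B (f e) b)"
    using rep by simp
  also have "\<dots> = (\<Sum>e\<in>E. \<Sum>b\<in>B. q b e * representation B (f e) b)"
    by (rule sum.swap)
  also have "\<dots> = (\<Sum>e\<in>E. q (f e) e)"
  proof (rule sum.cong[OF refl])
    fix e assume "e \<in> E"
    then have "f e \<in> span B" using onb_on_mem[OF E] fV B by auto
    then have "(\<Sum>b\<in>B. representation B (f e) b *\<^sub>R b) = f e"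
      using sum_representation_eq[OF B(1), of "f e" B] fin by simp
    then have "q (f e) e = q (\<Sum>b\<in>B. representation B (f e) b *\<^sub>R b) e" by simp
    then show "(\<Sum>b\<in>B. q b e * representation B (f e) b) = q (f e) e"
      by (simp add: q_simps mult.commute)
  qed
  finally show ?thesis .
qed

text \<open>This makes the choice inside \<open>tr_form\<close> harmless: one argument is expanded
  in the other basis, the sums are exchanged, and the expansion is undone.\<close>

lemma sum_bilinear_onb:
  assumes E: "onb q E" and F: "onb q F" and T: "bilinear (T :: 'g \<Rightarrow> 'g \<Rightarrow> real)"
  shows "(\<Sum>e\<in>E. T e e) = (\<Sum>f\<in>F. T f f)"
proof -
  have E': "onb_on UNIV E" and F': "onb_on UNIV F" using E F by (simp_all add: onb_UNIV_iff)
  have "(\<Sum>e\<in>E. T e e) = (\<Sum>e\<in>E. \<Sum>f\<in>F. q e f * T f e)"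
  proof (rule sum.cong[OF refl])
    fix e assume "e \<in> E"
    have "T e e = T (\<Sum>f\<in>F. q e f *\<^sub>R f) e" using onb_expand[OF F', of e] by simp
    then show "T e e = (\<Sum>f\<in>F. q e f * T f e)"
      by (simp add: bilinear_sum_both[OF T] bilinear_lmul[OF T])
  qed
  also have "\<dots> = (\<Sum>f\<in>F. \<Sum>e\<in>E. q e f * T f e)" by (rule sum.swap)
  also have "\<dots> = (\<Sum>f\<in>F. T f f)"
  proof (rule sum.cong[OF refl])
    fix f assume "f \<in> F"
    have "T f f = T f (\<Sum>e\<in>E. q f e *\<^sub>R e)" using onb_expand[OF E', of f] by simp
    then show "(\<Sum>e\<in>E. q e f * T f e) = T f f"
      by (simp add: bilinear_sum_both[OF T] bilinear_rmul[OF T] sym)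
  qed
  finally show ?thesis .
qed

lemma tr_form_eq:
  assumes E: "onb q E" and T: "bilinear T"
  shows "tr_form q T = (\<Sum>e\<in>E. T e e)"
  unfolding tr_form_def
proof (rule some_equality)
  show "\<exists>E'. onb q E' \<and> (\<Sum>e\<in>E. T e e) = (\<Sum>e\<in>E'. T e e)" using E by blast
  show "t = (\<Sum>e\<in>E. T e e)" if "\<exists>E'. onb q E' \<and> t = (\<Sum>e\<in>E'. T e e)" for t
    using that sum_bilinear_onb[OF _ E T] by blast
qed

lemma qproj_eq:
  assumes E: "onb_on V E"
  shows "qproj q V X = (\<Sum>e\<in>E. q X e *\<^sub>R e)"
  unfolding qproj_def
proof (rule the_equality)
  have "(\<Sum>e\<in>E. q X e *\<^sub>R e) \<in> V"
    unfolding onb_on_span[OF E, symmetric] by (intro span_sum span_scale span_base)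
  moreover have "q (X - (\<Sum>e\<in>E. q X e *\<^sub>R e)) z = 0" if "z \<in> V" for z
  proof -
    have "q X z = q X (\<Sum>e\<in>E. q z e *\<^sub>R e)" using onb_expand[OF E that] by simp
    then show ?thesis by (simp add: q_simps sym mult.commute)
  qed
  ultimately show "(\<Sum>e\<in>E. q X e *\<^sub>R e) \<in> V \<and> (\<forall>z\<in>V. q (X - (\<Sum>e\<in>E. q X e *\<^sub>R e)) z = 0)"
    by blast
next
  fix y assume y: "y \<in> V \<and> (\<forall>z\<in>V. q (X - y) z = 0)"
  then have "q y e = q X e" if "e \<in> E" for e
    using onb_on_mem[OF E that] by (simp add: q_simps)
  moreover have "y = (\<Sum>e\<in>E. q y e *\<^sub>R e)" using y onb_expand[OF E] by blast
  ultimately show "y = (\<Sum>e\<in>E. q X e *\<^sub>R e)" by simp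
qed

lemma Qres_eq:
  assumes E: "onb_on V E"
  shows "Qres q V X Y = (\<Sum>e\<in>E. q X e * q Y e)"
proof -
  have "Qres q V X Y = (\<Sum>e\<in>E. q X e * q e (\<Sum>f\<in>E. q Y f *\<^sub>R f))"
    by (simp add: Qres_def qproj_eq[OF E] bilinear_sum_both(1)[OF bil] q_simps(3))
  also have "\<dots> = (\<Sum>e\<in>E. q X e * q Y e)"
    using q_sum_onb[OF E] by (simp add: sym[of _ "\<Sum>f\<in>E. q Y f *\<^sub>R f"])
  finally show ?thesis .
qed

lemma bilinear_Qres:
  assumes E: "onb_on V E"
  shows "bilinear (Qres q V)"
proof -
  have "bilinear (\<lambda>X Y. \<Sum>e\<in>E. q X e * q Y e)"
    unfolding bilinear_def
  proof (intro conjI allI)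
    show "linear (\<lambda>Y. \<Sum>e\<in>E. q X e * q Y e)" for X
      by (rule linearI) (simp_all add: q_simps distrib_left sum.distrib sum_distrib_left mult.left_commute)
    show "linear (\<lambda>X. \<Sum>e\<in>E. q X e * q Y e)" for Y
      by (rule linearI) (simp_all add: q_simps distrib_right sum.distrib sum_distrib_left mult.assoc)
  qed
  moreover have "Qres q V = (\<lambda>X Y. \<Sum>e\<in>E. q X e * q Y e)"
    by (intro ext Qres_eq[OF E])
  ultimately show ?thesis by simp
qed

end

section \<open>Forms that are a multiple of \<open>q\<close> on each summand of an orthogonal
  decomposition\<close>

locale orthogonal_decomposition = inner_form q
  for q :: "'g::euclidean_space \<Rightarrow> 'g \<Rightarrow> real" +
  fixes J :: "'j set" and V E :: "'j \<Rightarrow> 'g set"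
  assumes fin_J: "finite J"
    and onb_V: "i \<in> J \<Longrightarrow> onb_on (V i) (E i)"
    and orth_V: "i \<in> J \<Longrightarrow> j \<in> J \<Longrightarrow> i \<noteq> j \<Longrightarrow> x \<in> V i \<Longrightarrow> y \<in> V j \<Longrightarrow> q x y = 0"
    and span_V: "span (\<Union>i\<in>J. V i) = UNIV"
begin

lemma E_in_V: "i \<in> J \<Longrightarrow> e \<in> E i \<Longrightarrow> e \<in> V i"
  using onb_V onb_on_mem by blast

lemma fin_E: "i \<in> J \<Longrightarrow> finite (E i)"
  using onb_V onb_on_finite by blast

lemma card_E: "i \<in> J \<Longrightarrow> card (E i) = dim (V i)"
  using onb_V onb_on_card by blast

text \<open>No sign is imposed on the coefficients: the same construction yields the metrics and the
  tensor \<open>T\<close>, which is negative on p.\<close>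

definition diag :: "('j \<Rightarrow> real) \<Rightarrow> 'g \<Rightarrow> 'g \<Rightarrow> real" where
  "diag \<mu> X Y = (\<Sum>i\<in>J. \<mu> i * Qres q (V i) X Y)"

definition scaled_basis :: "('j \<Rightarrow> real) \<Rightarrow> 'g set" where
  "scaled_basis \<mu> = (\<Union>i\<in>J. (\<lambda>e. (1 / sqrt (\<mu> i)) *\<^sub>R e) ` E i)"

lemma diag_eq: "diag \<mu> X Y = (\<Sum>i\<in>J. \<mu> i * (\<Sum>e\<in>E i. q X e * q Y e))"
  by (simp add: diag_def Qres_eq[OF onb_V] cong: sum.cong)

lemma bilinear_diag: "bilinear (diag \<mu>)"
proof -
  have b: "bilinear (Qres q (V i))" if "i \<in> J" for i using bilinear_Qres[OF onb_V[OF that]] .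
  show ?thesis
    unfolding bilinear_def diag_def
    by (intro conjI allI linearI)
      (simp_all add: bilinear_ladd[OF b] bilinear_radd[OF b] bilinear_lmul[OF b] bilinear_rmul[OF b]
        distrib_left sum.distrib sum_distrib_left mult.left_commute cong: sum.cong)
qed

lemma diag_basis:
  assumes i: "i \<in> J" and e: "e \<in> E i"
  shows "diag \<mu> X e = \<mu> i * q X e"
proof -
  have "(\<Sum>f\<in>E j. q X f * q e f) = (if j = i then q X e else 0)" if j: "j \<in> J" for j
  proof (cases "j = i")
    case True
    have "(\<Sum>f\<in>E i. q X f * q e f) = (\<Sum>f\<in>E i. if f = e then q X f else 0)"
      using onb_on_delta[OF onb_V[OF i] e] by (intro sum.cong refl) auto
    then show ?thesis using True e fin_E[OF i] by simp
  next
    case False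
    then have "q e f = 0" if "f \<in> E j" for f
      using orth_V[OF i j _ E_in_V[OF i e] E_in_V[OF j that]] by simp
    then show ?thesis using False by simp
  qed
  then have "diag \<mu> X e = (\<Sum>j\<in>J. if j = i then \<mu> i * q X e else 0)"
    unfolding diag_eq by (intro sum.cong refl) auto
  then show ?thesis using i fin_J by simp
qed

lemma span_E: "span (\<Union>i\<in>J. E i) = UNIV"
proof -
  have "V i \<subseteq> span (\<Union>i\<in>J. E i)" if "i \<in> J" for i
    using onb_on_span[OF onb_V[OF that]] span_mono[of "E i" "\<Union>i\<in>J. E i"] that by blast
  then have "span (\<Union>i\<in>J. V i) \<subseteq> span (\<Union>i\<in>J. E i)"
    by (intro span_minimal) auto
  then show ?thesis using span_V by blast
qed

lemma zero_if_orth_E: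
  assumes "\<And>i e. i \<in> J \<Longrightarrow> e \<in> E i \<Longrightarrow> q X e = 0"
  shows "X = 0"
proof -
  have "X \<in> span (\<Union>i\<in>J. E i)" using span_E by simp
  then have "q X X = 0"
    by (induction rule: span_induct_alt[of _ _ "\<lambda>Y. q X Y = 0"]) (use assms in \<open>auto simp: q_simps\<close>)
  then show ?thesis by (simp add: q_eq_0_iff)
qed

lemma inner_form_diag:
  assumes "\<And>i. i \<in> J \<Longrightarrow> 0 < \<mu> i"
  shows "inner_form (diag \<mu>)"
proof
  show "bilinear (diag \<mu>)" by (rule bilinear_diag)
  show "diag \<mu> x y = diag \<mu> y x" for x y by (simp add: diag_eq mult.commute)
  fix x :: 'g assume "x \<noteq> 0"
  then obtain i e where ie: "i \<in> J" "e \<in> E i" "q x e \<noteq> 0" using zero_if_orth_E by blast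
  have nn: "0 \<le> (\<Sum>e\<in>E j. q x e * q x e)" for j by (intro sum_nonneg) simp
  have "0 < q x e * q x e" using ie by (simp add: zero_less_mult_iff) linarith
  also have "\<dots> \<le> (\<Sum>e\<in>E i. q x e * q x e)"
    by (rule member_le_sum) (use ie fin_E in auto)
  finally have "0 < \<mu> i * (\<Sum>e\<in>E i. q x e * q x e)" using assms ie by simp
  also have "\<dots> \<le> diag \<mu> x x"
    unfolding diag_eq
    by (rule member_le_sum[where f = "\<lambda>i. \<mu> i * (\<Sum>e\<in>E i. q x e * q x e)"])
      (use ie fin_J nn assms in \<open>auto intro!: mult_nonneg_nonneg simp: less_imp_le\<close>)
  finally show "0 < diag \<mu> x x" .
qed

lemma sum_scaled_basis:
  assumes "\<And>i. i \<in> J \<Longrightarrow> 0 < \<mu> i"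
  shows "(\<Sum>e\<in>scaled_basis \<mu>. h e) = (\<Sum>i\<in>J. \<Sum>e\<in>E i. h ((1 / sqrt (\<mu> i)) *\<^sub>R e))"
proof -
  have "(\<Sum>e\<in>scaled_basis \<mu>. h e) = (\<Sum>i\<in>J. sum h ((\<lambda>e. (1 / sqrt (\<mu> i)) *\<^sub>R e) ` E i))"
    unfolding scaled_basis_def
  proof (rule sum.UNION_disjoint[OF fin_J])
    show "\<forall>i\<in>J. finite ((\<lambda>e. (1 / sqrt (\<mu> i)) *\<^sub>R e) ` E i)" using fin_E by simp
    show "\<forall>i\<in>J. \<forall>j\<in>J. i \<noteq> j \<longrightarrow>
      (\<lambda>e. (1 / sqrt (\<mu> i)) *\<^sub>R e) ` E i \<inter> (\<lambda>e. (1 / sqrt (\<mu> j)) *\<^sub>R e) ` E j = {}"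
    proof (intro ballI impI equals0I)
      fix i j x assume ij: "i \<in> J" "j \<in> J" "i \<noteq> j"
        and "x \<in> (\<lambda>e. (1 / sqrt (\<mu> i)) *\<^sub>R e) ` E i \<inter> (\<lambda>e. (1 / sqrt (\<mu> j)) *\<^sub>R e) ` E j"
      then obtain e f where e: "e \<in> E i" "x = (1 / sqrt (\<mu> i)) *\<^sub>R e"
        and f: "f \<in> E j" "x = (1 / sqrt (\<mu> j)) *\<^sub>R f" by blast
      \<comment> \<open>A vector common to two scaled blocks would make \<open>e\<close> a multiple
        of a vector of an orthogonal summand, against \<open>q e e = 1\<close>.\<close>
      have "e = (sqrt (\<mu> i) / sqrt (\<mu> j)) *\<^sub>R f"
        using arg_cong[OF trans[OF e(2)[symmetric] f(2)], of "(*\<^sub>R) (sqrt (\<mu> i))"] assms[OF ij(1)]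
        by simp
      then have "q e e = (sqrt (\<mu> i) / sqrt (\<mu> j)) * q e f"
        using q_simps(4)[of e _ f] by (metis real_scaleR_def)
      moreover have "q e f = 0"
        using orth_V[OF ij E_in_V[OF ij(1) e(1)] E_in_V[OF ij(2) f(1)]] .
      ultimately show False using onb_on_unit[OF onb_V[OF ij(1)] e(1)] by simp
    qed
  qed
  also have "\<dots> = (\<Sum>i\<in>J. \<Sum>e\<in>E i. h ((1 / sqrt (\<mu> i)) *\<^sub>R e))"
  proof (rule sum.cong[OF refl])
    fix i assume "i \<in> J"
    then have "inj_on (\<lambda>e. (1 / sqrt (\<mu> i)) *\<^sub>R e) (E i)"
      using assms[of i] by (auto intro!: inj_onI)
    then show "sum h ((\<lambda>e. (1 / sqrt (\<mu> i)) *\<^sub>R e) ` E i) = (\<Sum>e\<in>E i. h ((1 / sqrt (\<mu> i)) *\<^sub>R e))"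
      by (simp add: sum.reindex)
  qed
  finally show ?thesis .
qed

lemma onb_scaled_basis:
  assumes pos': "\<And>i. i \<in> J \<Longrightarrow> 0 < \<mu> i"
  shows "onb (diag \<mu>) (scaled_basis \<mu>)"
  unfolding onb_def
proof (intro conjI ballI impI)
  interpret d: inner_form "diag \<mu>" by (rule inner_form_diag[OF pos'])
  show "finite (scaled_basis \<mu>)" using fin_J fin_E by (auto simp: scaled_basis_def)
  have "E i \<subseteq> span (scaled_basis \<mu>)" if i: "i \<in> J" for i
  proof
    fix e assume "e \<in> E i"
    then have "(1 / sqrt (\<mu> i)) *\<^sub>R e \<in> span (scaled_basis \<mu>)"
      using i by (intro span_base) (auto simp: scaled_basis_def)
    from span_scale[OF this, of "sqrt (\<mu> i)"] show "e \<in> span (scaled_basis \<mu>)"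
      using pos'[OF i] by simp
  qed
  then have "span (\<Union>i\<in>J. E i) \<subseteq> span (scaled_basis \<mu>)"
    by (intro span_minimal) auto
  then show "span (scaled_basis \<mu>) = UNIV" using span_E by blast
  have prod: "diag \<mu> ((1 / sqrt (\<mu> i)) *\<^sub>R e) ((1 / sqrt (\<mu> j)) *\<^sub>R f)
     = (\<mu> j / (sqrt (\<mu> i) * sqrt (\<mu> j))) * q e f"
    if "j \<in> J" "f \<in> E j" for i j e f
    using that by (simp add: d.q_simps diag_basis)
  {
    fix x assume "x \<in> scaled_basis \<mu>"
    then obtain i e where ie: "i \<in> J" "e \<in> E i" "x = (1 / sqrt (\<mu> i)) *\<^sub>R e"
      by (auto simp: scaled_basis_def)
    then show "diag \<mu> x x = 1"
      using prod[OF ie(1,2), of i e] pos'[OF ie(1)] onb_on_unit[OF onb_V[OF ie(1)] ie(2)] by simp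
    fix y assume "y \<in> scaled_basis \<mu>" and xy: "x \<noteq> y"
    then obtain j f where jf: "j \<in> J" "f \<in> E j" "y = (1 / sqrt (\<mu> j)) *\<^sub>R f"
      by (auto simp: scaled_basis_def)
    have "q e f = 0"
    proof (cases "i = j")
      case True
      then have "e \<noteq> f" using xy ie jf by auto
      then show ?thesis using onb_on_orth[OF onb_V[OF ie(1)] ie(2)] jf True by simp
    next
      case False
      then show ?thesis using orth_V ie jf E_in_V by blast
    qed
    then show "diag \<mu> x y = 0" using prod[OF jf(1,2), of i e] ie jf by simp
  }
qed

lemma tr_form_diag:
  assumes "\<And>i. i \<in> J \<Longrightarrow> 0 < \<mu> i"
  shows "tr_form (diag \<mu>) (diag \<tau>) = (\<Sum>i\<in>J. real (dim (V i)) * \<tau> i / \<mu> i)"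
proof -
  interpret d: inner_form "diag \<mu>" by (rule inner_form_diag[OF assms])
  have "tr_form (diag \<mu>) (diag \<tau>) = (\<Sum>i\<in>J. \<Sum>e\<in>E i. diag \<tau> ((1 / sqrt (\<mu> i)) *\<^sub>R e) ((1 / sqrt (\<mu> i)) *\<^sub>R e))"
    using d.tr_form_eq[OF onb_scaled_basis[OF assms] bilinear_diag] sum_scaled_basis[OF assms] by simp
  also have "\<dots> = (\<Sum>i\<in>J. \<Sum>e\<in>E i. \<tau> i / \<mu> i)"
  proof (intro sum.cong refl)
    fix i e assume i: "i \<in> J" and e: "e \<in> E i"
    show "diag \<tau> ((1 / sqrt (\<mu> i)) *\<^sub>R e) ((1 / sqrt (\<mu> i)) *\<^sub>R e) = \<tau> i / \<mu> i"
      using assms[OF i] onb_on_unit[OF onb_V[OF i] e]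
      by (simp add: bilinear_lmul[OF bilinear_diag] bilinear_rmul[OF bilinear_diag] diag_basis[OF i e] q_simps)
  qed
  also have "\<dots> = (\<Sum>i\<in>J. real (dim (V i)) * \<tau> i / \<mu> i)"
    by (simp add: card_E cong: sum.cong)
  finally show ?thesis .
qed

text \<open>With all coefficients equal to 1, facts about scaled bases become facts about
  \<open>q\<close> and the union of the \<open>E i\<close>; this also makes the trace with respect
  to Q a special case of \<open>tr_form_diag\<close>.\<close>

lemma diag_one: "diag (\<lambda>_. 1) = q"
proof (intro ext)
  fix X Y
  interpret d: inner_form "diag (\<lambda>_. 1)" by (rule inner_form_diag) simp
  have "diag (\<lambda>_. 1) X Y = q X Y" if "Y \<in> span (\<Union>i\<in>J. E i)" for Y
    using that
    by (induction rule: span_induct_alt) (auto simp: q_simps d.q_simps diag_basis)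
  then show "diag (\<lambda>_. 1) X Y = q X Y" using span_E by simp
qed

lemma onb_E: "onb q (\<Union>i\<in>J. E i)"
  using onb_scaled_basis[of "\<lambda>_. 1"] by (simp add: diag_one scaled_basis_def)

lemma sum_E: "(\<Sum>e\<in>(\<Union>i\<in>J. E i). h e) = (\<Sum>i\<in>J. \<Sum>e\<in>E i. h e)"
  using sum_scaled_basis[of "\<lambda>_. 1" h] by (simp add: scaled_basis_def)

end

section \<open>Scalar curvature of unimodular metric Lie algebras\<close>

locale metric_lie_algebra = inner_form g for g :: "'g::euclidean_space \<Rightarrow> 'g \<Rightarrow> real" +
  fixes br :: "'g \<Rightarrow> 'g \<Rightarrow> 'g"
  assumes lie: "lie_bracket br"
begin

lemma bil_br: "bilinear br"
  using lie unfolding lie_bracket_def bilinear_def by blast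

lemma linear_br: "linear (br X)"
  using bil_br by (simp add: bilinear_def)

lemma br_skew: "br X Y = - br Y X"
  using lie unfolding lie_bracket_def by blast

lemmas br_simps =
  bilinear_ladd[OF bil_br] bilinear_radd[OF bil_br] bilinear_lmul[OF bil_br] bilinear_rmul[OF bil_br]
  bilinear_lneg[OF bil_br] bilinear_rneg[OF bil_br] bilinear_lsub[OF bil_br] bilinear_rsub[OF bil_br]
  bilinear_lzero[OF bil_br] bilinear_rzero[OF bil_br]

definition koszul :: "'g \<Rightarrow> 'g \<Rightarrow> 'g \<Rightarrow> real" where
  "koszul X Y Z = (g (br X Y) Z - g (br Y Z) X + g (br Z X) Y) / 2"

text \<open>The Koszul expression is linear in \<open>Z\<close>, so an orthonormal basis represents
  it by a vector, unique by definiteness; hence the definite description in \<open>lc_conn\<close>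
  denotes.\<close>

lemma lc_conn_koszul: "g (lc_conn br g X Y) Z = koszul X Y Z"
proof -
  obtain E where E: "onb_on UNIV E" using exists_onb_on[of UNIV] by auto
  have lin: "linear (koszul X Y)"
    unfolding koszul_def
    by (auto intro!: linearI simp: q_simps br_simps algebra_simps add_divide_distrib diff_divide_distrib)
  have ex: "\<exists>W. \<forall>Z. g W Z = koszul X Y Z"
  proof (intro exI allI)
    fix Z
    have "koszul X Y Z = koszul X Y (\<Sum>e\<in>E. g Z e *\<^sub>R e)" using onb_expand[OF E, of Z] by simp
    also have "\<dots> = (\<Sum>e\<in>E. g Z e * koszul X Y e)"
      by (simp add: linear_sum[OF lin] linear_scale[OF lin])
    finally show "g (\<Sum>e\<in>E. koszul X Y e *\<^sub>R e) Z = koszul X Y Z"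
      by (simp add: q_simps sym mult.commute)
  qed
  have "\<exists>!W. \<forall>Z. g W Z = koszul X Y Z"
    using ex q_eqI by (metis (no_types))
  from theI'[OF this] show ?thesis unfolding lc_conn_def koszul_def by blast
qed

lemma bilinear_lc_conn: "bilinear (lc_conn br g)"
  unfolding bilinear_def
  by (auto intro!: linearI q_eqI simp: q_simps lc_conn_koszul koszul_def br_simps
      algebra_simps add_divide_distrib diff_divide_distrib)

lemma koszul_skew: "koszul X Y Z = - koszul X Z Y"
  unfolding koszul_def using br_skew[of Y Z] br_skew[of X Y] br_skew[of Z X]
  by (simp add: q_simps field_simps)

lemma lc_conn_metric: "g (lc_conn br g X Y) Z = - g Y (lc_conn br g X Z)"
  using koszul_skew[of X Y Z] lc_conn_koszul[of X Y Z] lc_conn_koszul[of X Z Y] sym[of Y "lc_conn br g X Z"]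
  by simp

lemma g_curv:
  "g (curv br g X Y Y) X = - g (lc_conn br g Y Y) (lc_conn br g X X)
     + g (lc_conn br g X Y) (lc_conn br g Y X) - koszul (br X Y) Y X"
  unfolding curv_def
  using lc_conn_metric[of X "lc_conn br g Y Y" X] lc_conn_metric[of Y "lc_conn br g X Y" X]
  by (simp add: q_simps lc_conn_koszul)

lemma linear_curv: "linear (\<lambda>X. curv br g X Y Z)" "linear (\<lambda>Y. curv br g X Y Z)"
  "linear (\<lambda>Z. curv br g X Y Z)"
proof -
  note lc = bilinear_ladd[OF bilinear_lc_conn] bilinear_radd[OF bilinear_lc_conn]
    bilinear_lmul[OF bilinear_lc_conn] bilinear_rmul[OF bilinear_lc_conn]
  show "linear (\<lambda>X. curv br g X Y Z)" "linear (\<lambda>Y. curv br g X Y Z)"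
    "linear (\<lambda>Z. curv br g X Y Z)"
    unfolding curv_def by (auto intro!: linearI simp: lc br_simps algebra_simps)
qed

lemma scal_eq_sum_curv:
  assumes E: "onb g E"
  shows "scal br g = (\<Sum>f\<in>E. \<Sum>e\<in>E. g (curv br g e f f) e)"
proof -
  have E': "onb_on UNIV E" using E by (simp add: onb_UNIV_iff)
  have ric: "ricci br g = (\<lambda>Y Z. \<Sum>e\<in>E. g (curv br g e Y Z) e)"
    unfolding ricci_def using trace_on_eq[OF E' linear_curv(1)] by (intro ext) simp
  have "bilinear (ricci br g)"
    unfolding ric bilinear_def
    by (auto intro!: linearI simp: linear_add[OF linear_curv(2)] linear_add[OF linear_curv(3)]
        linear_scale[OF linear_curv(2)] linear_scale[OF linear_curv(3)] q_simps sum.distrib sum_distrib_left)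
  from tr_form_eq[OF E this] show ?thesis by (simp add: scal_def ric)
qed

lemma killing_eq:
  assumes E: "onb g E"
  shows "killing br X Y = (\<Sum>e\<in>E. g (br X (br Y e)) e)"
proof -
  have "linear (\<lambda>Z. br X (br Y Z))" by (auto intro!: linearI simp: br_simps)
  with trace_on_eq[of UNIV E] E show ?thesis
    by (simp add: killing_def killing_on_def onb_UNIV_iff)
qed

lemma sum_cyclic:
  "(\<Sum>a\<in>E. \<Sum>b\<in>E. \<Sum>c\<in>E. h b c a) = (\<Sum>a\<in>E. \<Sum>b\<in>E. \<Sum>c\<in>E. (h a b c :: real))"
proof -
  have "(\<Sum>a\<in>E. \<Sum>b\<in>E. \<Sum>c\<in>E. h b c a) = (\<Sum>b\<in>E. \<Sum>a\<in>E. \<Sum>c\<in>E. h b c a)" by (rule sum.swap)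
  also have "\<dots> = (\<Sum>b\<in>E. \<Sum>c\<in>E. \<Sum>a\<in>E. h b c a)" by (rule sum.cong[OF refl], rule sum.swap)
  finally show ?thesis .
qed

text \<open>In structure constants \<open>c\<close>, every term of the curvature sum is a quadratic
  monomial summed over all triples. Skewness and cyclic relabelling leave two sums:
  \<open>P\<close>, the squares, and \<open>R\<close>, the products of two cyclic shifts. The three
  parts of the curvature contribute \<open>0\<close>, \<open>P/4 - R/2\<close> and
  \<open>-(P/2 - R)\<close>, while the trace of the Killing form is \<open>-R\<close>.\<close>

theorem scal_unimodular:
  assumes E: "onb g E" and uni: "\<And>Z. trace_on UNIV (br Z) = 0"
  shows "scal br g = - (\<Sum>e\<in>E. \<Sum>f\<in>E. \<Sum>h\<in>E. (g (br e f) h)\<^sup>2) / 4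
                     - (\<Sum>e\<in>E. killing br e e) / 2"
proof -
  have E': "onb_on UNIV E" using E by (simp add: onb_UNIV_iff)
  define c where "c x y z = g (br x y) z" for x y z
  have cs: "c y x z = - c x y z" for x y z
    unfolding c_def using br_skew[of y x] by (simp add: q_simps)
  let ?S = "\<lambda>h :: 'g \<Rightarrow> 'g \<Rightarrow> 'g \<Rightarrow> real. \<Sum>e\<in>E. \<Sum>f\<in>E. \<Sum>k\<in>E. h e f k"
  define P where "P = ?S (\<lambda>e f k. (c e f k)\<^sup>2)"
  define R where "R = ?S (\<lambda>e f k. c f k e * c k e f)"
  have P2: "?S (\<lambda>e f k. (c f k e)\<^sup>2) = P" unfolding P_def by (rule sum_cyclic)
  have P3: "?S (\<lambda>e f k. (c k e f)\<^sup>2) = P"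
    unfolding P2[symmetric] by (rule sum_cyclic[of "\<lambda>e f k. (c f k e)\<^sup>2"])
  have R2: "?S (\<lambda>e f k. c k e f * c e f k) = R" unfolding R_def
    by (rule sum_cyclic[of "\<lambda>e f k. c f k e * c k e f"])
  have R3: "?S (\<lambda>e f k. c e f k * c f k e) = R" unfolding R2[symmetric]
    by (rule sum_cyclic[of "\<lambda>e f k. c k e f * c e f k"])
  have kos: "koszul x y z = (c x y z - c y z x + c z x y) / 2" for x y z
    by (simp add: koszul_def c_def)
  have t1: "(\<Sum>f\<in>E. \<Sum>e\<in>E. g (lc_conn br g f f) (lc_conn br g e e)) = 0"
  proof -
    \<comment> \<open>The sum of the vectors \<open>lc_conn br g f f\<close> pairs with
      \<open>z\<close> to the trace of ad z, which unimodularity makes zero.\<close>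
    have "(\<Sum>f\<in>E. g (lc_conn br g f f) z) = 0" for z
    proof -
      have "(\<Sum>f\<in>E. g (lc_conn br g f f) z) = (\<Sum>f\<in>E. g (br z f) f)"
      proof (rule sum.cong[OF refl])
        fix f
        show "g (lc_conn br g f f) z = g (br z f) f"
          using cs[of f f f] cs[of f f z] cs[of f z f]
          by (simp add: lc_conn_koszul kos c_def[symmetric])
      qed
      also have "\<dots> = trace_on UNIV (br z)"
        using trace_on_eq[OF E' linear_br] by simp
      finally show ?thesis using uni by simp
    qed
    then show ?thesis by (subst sum.swap) simp
  qed
  have t2: "(\<Sum>f\<in>E. \<Sum>e\<in>E. g (lc_conn br g e f) (lc_conn br g f e)) = P / 4 - R / 2"
  proof -
    have "g (lc_conn br g e f) (lc_conn br g f e) = (\<Sum>k\<in>E. koszul e f k * koszul f e k)" for e f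
      by (subst onb_parseval[OF E' UNIV_I]) (simp add: lc_conn_koszul)
    then have "(\<Sum>f\<in>E. \<Sum>e\<in>E. g (lc_conn br g e f) (lc_conn br g f e))
        = ?S (\<lambda>e f k. koszul e f k * koszul f e k)"
      by (subst sum.swap) simp
    also have "\<dots> = ?S (\<lambda>e f k. (c f k e)\<^sup>2 / 4 + (c k e f)\<^sup>2 / 4 - (c e f k)\<^sup>2 / 4
                              - c f k e * c k e f / 2)"
    proof (intro sum.cong refl)
      fix e f k
      show "koszul e f k * koszul f e k = (c f k e)\<^sup>2 / 4 + (c k e f)\<^sup>2 / 4 - (c e f k)\<^sup>2 / 4
                              - c f k e * c k e f / 2"
        unfolding kos cs[of f e k] cs[of e k f] cs[of k f e]
        by (simp add: power2_eq_square field_simps)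
    qed
    also have "\<dots> = P / 4 + P / 4 - P / 4 - R / 2"
      unfolding sum.distrib sum_subtractf sum_divide_distrib[symmetric] P2 P3
      by (simp add: P_def R_def)
    finally show ?thesis by simp
  qed
  have t3: "(\<Sum>f\<in>E. \<Sum>e\<in>E. koszul (br e f) f e) = P / 2 - R"
  proof -
    have lin: "linear (\<lambda>X. koszul X y z)" for y z
      unfolding koszul_def
      by (auto intro!: linearI simp: q_simps br_simps algebra_simps add_divide_distrib diff_divide_distrib)
    have ex: "koszul x y z = (\<Sum>k\<in>E. g x k * koszul k y z)" for x y z
      by (subst onb_expand[OF E', of x]) (simp_all add: linear_sum[OF lin] linear_scale[OF lin])
    have "(\<Sum>f\<in>E. \<Sum>e\<in>E. koszul (br e f) f e) = ?S (\<lambda>e f k. c e f k * koszul k f e)"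
      by (subst sum.swap) (simp add: ex[of "br _ _"] c_def)
    also have "\<dots> = ?S (\<lambda>e f k. (c e f k)\<^sup>2 / 2 - c e f k * c f k e / 2 - c k e f * c e f k / 2)"
    proof (intro sum.cong refl)
      fix e f k
      show "c e f k * koszul k f e
        = (c e f k)\<^sup>2 / 2 - c e f k * c f k e / 2 - c k e f * c e f k / 2"
        unfolding kos cs[of f e k] cs[of e k f] cs[of k f e]
        by (simp add: power2_eq_square field_simps)
    qed
    also have "\<dots> = P / 2 - R / 2 - R / 2"
      unfolding sum.distrib sum_subtractf sum_divide_distrib[symmetric] R2 R3
      by (simp add: P_def)
    finally show ?thesis by simp
  qed
  have K: "(\<Sum>e\<in>E. killing br e e) = - R"
  proof -
    have "(\<Sum>k\<in>E. killing br k k) = ?S (\<lambda>k e f. c k e f * c k f e)"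
    proof (rule sum.cong[OF refl])
      fix k
      have "g (br k (br k e)) e = (\<Sum>f\<in>E. c k e f * c k f e)" for e
      proof -
        have "br k (br k e) = br k (\<Sum>f\<in>E. g (br k e) f *\<^sub>R f)"
          using onb_expand[OF E', of "br k e"] by simp
        then show ?thesis
          by (simp add: bilinear_sum_both[OF bil_br] br_simps q_simps c_def)
      qed
      then show "killing br k k = (\<Sum>e\<in>E. \<Sum>f\<in>E. c k e f * c k f e)"
        by (simp add: killing_eq[OF E])
    qed
    also have "\<dots> = ?S (\<lambda>k e f. - (c f k e * c k e f))"
    proof (intro sum.cong refl)
      show "c k e f * c k f e = - (c f k e * c k e f)" for k e f
        using cs[of f k e] by simp
    qed
    also have "\<dots> = - ?S (\<lambda>k e f. c k e f * c f k e)" by (simp add: sum_negf mult.commute)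
    also have "?S (\<lambda>k e f. c k e f * c f k e) = R"
      using R2 by (simp add: mult.commute)
    finally show ?thesis .
  qed
  have "scal br g = (\<Sum>f\<in>E. \<Sum>e\<in>E. - g (lc_conn br g f f) (lc_conn br g e e)
     + g (lc_conn br g e f) (lc_conn br g f e) - koszul (br e f) f e)"
    by (simp add: scal_eq_sum_curv[OF E] g_curv)
  also have "\<dots> = - 0 + (P / 4 - R / 2) - (P / 2 - R)"
    unfolding sum.distrib sum_subtractf sum_negf t1 t2 t3 by simp
  finally show ?thesis unfolding K P_def c_def by simp
qed

end

section \<open>The optimisation problem\<close>

text \<open>Tychonoff for functions on an arbitrary index type. The application pins the coordinates
  outside the finite set \<open>I\<close> to 0, so no passage to a finite-dimensional type is
  needed.\<close>

lemma compact_box_fun: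
  fixes l u :: "'i \<Rightarrow> real"
  shows "compact {x. \<forall>i. l i \<le> x i \<and> x i \<le> u i}"
proof -
  have "compactin (product_topology (\<lambda>i. euclidean) UNIV) (PiE UNIV (\<lambda>i. {l i..u i}))"
    unfolding compactin_PiE by auto
  moreover have "PiE UNIV (\<lambda>i. {l i..u i}) = {x. \<forall>i. l i \<le> x i \<and> x i \<le> u i}"
    by (auto simp: PiE_def Pi_def)
  ultimately show ?thesis
    by (simp add: euclidean_product_topology flip: compactin_euclidean_iff)
qed

text \<open>The analytic problem stripped of Lie theory. Here \<open>m_max\<close> ranges over all
  of \<open>I\<close>, the centre included, and \<open>n_eq\<close> is the identity later supplied
  by \<open>dim_p_eq\<close>.\<close>

locale scal_functional =
  fixes I :: "'i set" and d \<kappa> T :: "'i \<Rightarrow> real" and n Tp :: real and m :: 'i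
  assumes fin: "finite I" and m: "m \<in> I"
    and d_pos: "\<And>i. i \<in> I \<Longrightarrow> 0 < d i"
    and kappa_nonneg: "\<And>i. i \<in> I \<Longrightarrow> 0 \<le> \<kappa> i"
    and kappa_less: "\<And>i. i \<in> I \<Longrightarrow> \<kappa> i < 1"
    and T_pos: "\<And>i. i \<in> I \<Longrightarrow> 0 < T i"
    and n_pos: "0 < n" and Tp_pos: "0 < Tp"
    and n_eq: "n = 2 * (\<Sum>i\<in>I. d i * (1 - \<kappa> i))"
    and m_max: "\<And>i. i \<in> I \<Longrightarrow> \<kappa> i / T i \<le> \<kappa> m / T m"
    and cond1: "\<kappa> m * ((\<Sum>i\<in>I. d i * T i) - n * Tp) / T m
        < (\<Sum>i\<in>I. d i) + d m * (1 - \<kappa> m) - 3 * n"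
    and cond2: "(\<Sum>i\<in>I. (n\<^sup>2 * \<kappa> i * Tp\<^sup>2 - (d i)\<^sup>2 * (1 - \<kappa> i) * (T i)\<^sup>2) / (n * Tp * T i))
        - 2 * n < 0"
begin

definition c :: "'i \<Rightarrow> real" where "c i = d i * (1 - \<kappa> i)"
definition w :: "'i \<Rightarrow> real" where "w i = d i * T i"
definition L :: real where "L = \<kappa> m / T m"

text \<open>Four times the scalar curvature in the coordinates \<open>x i = 1 / \<alpha> i\<close>, \<open>y = 1 / \<beta>\<close>;
  in these the trace constraint is affine.\<close>
definition G :: "('i \<Rightarrow> real) \<Rightarrow> real \<Rightarrow> real" where
  "G x y = (\<Sum>i\<in>I. d i * \<kappa> i * x i - y\<^sup>2 * c i / x i) - 2 * n * y"

definition feasible :: "('i \<Rightarrow> real) \<Rightarrow> real \<Rightarrow> bool" where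
  "feasible x y \<longleftrightarrow> (\<forall>i\<in>I. 0 < x i) \<and> 0 < y \<and> (\<Sum>i\<in>I. w i * x i) = 1 + n * Tp * y"

lemma c_pos: "i \<in> I \<Longrightarrow> 0 < c i" and w_pos: "i \<in> I \<Longrightarrow> 0 < w i"
  by (simp_all add: c_def w_def d_pos kappa_less T_pos)

lemma L_nonneg: "0 \<le> L"
  using kappa_nonneg[OF m] T_pos[OF m] by (simp add: L_def)

lemma dk_le: "i \<in> I \<Longrightarrow> d i * \<kappa> i \<le> L * w i"
  using mult_left_mono[OF m_max[of i], of "d i * T i"] T_pos[of i] d_pos[of i]
  by (simp add: L_def w_def mult_ac)

text \<open>Along the curve with \<open>y\<close> and all \<open>x i\<close>,
  \<open>i \<noteq> m\<close>, equal to \<open>t\<close>, the constraint forces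
  \<open>w m * x m = 1 + u * t\<close>, and \<open>G\<close> equals
  \<open>L + t * (P - t * (c m * w m) / (1 + u * t))\<close> exactly. Any fixed ratio of
  \<open>x i\<close> to \<open>y\<close> would give a first-order gain or loss; ratio 1 is the one
  for which positivity of its coefficient \<open>P\<close> is the assumption
  \<open>cond1\<close>.\<close>

lemma exists_better_than_L: "\<exists>x y. feasible x y \<and> L < G x y"
proof -
  define u where "u = n * Tp - (\<Sum>i\<in>I - {m}. w i)"
  define P where "P = (\<Sum>i\<in>I - {m}. d i * \<kappa> i - c i) + L * u - 2 * n"
  have remove: "(\<Sum>i\<in>I. f i) = f m + (\<Sum>i\<in>I - {m}. f i)" for f :: "'i \<Rightarrow> real"
    by (rule sum.remove[OF fin m])
  have dk: "d m * \<kappa> m = L * w m" using T_pos[OF m] by (simp add: L_def w_def)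
  \<comment> \<open>Since \<open>d i = d i * \<kappa> i + c i\<close> and \<open>n\<close> is twice
    the sum of the \<open>c i\<close>, changing the sign in front of \<open>c i\<close> costs
    exactly \<open>n\<close>.\<close>
  have "(\<Sum>i\<in>I. d i) = (\<Sum>i\<in>I. d i * \<kappa> i - c i) + n"
    by (simp add: n_eq c_def algebra_simps sum.distrib sum_subtractf sum_distrib_left)
  moreover have "\<kappa> m * ((\<Sum>i\<in>I. d i * T i) - n * Tp) / T m = L * w m - L * u"
  proof -
    have "\<kappa> m * ((\<Sum>i\<in>I. d i * T i) - n * Tp) / T m = L * ((\<Sum>i\<in>I. w i) - n * Tp)"
      by (simp add: L_def w_def)
    then show ?thesis by (simp add: remove[of w] u_def algebra_simps)
  qed
  ultimately have P: "0 < P"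
    using cond1 dk remove[of "\<lambda>i. d i * \<kappa> i - c i"] by (simp add: P_def c_def right_diff_distrib)
  have "((\<lambda>t. 1 + u * t) \<longlongrightarrow> 1 + u * 0) (at_right 0)"
    by (intro tendsto_intros)
  then have e1: "\<forall>\<^sub>F t in at_right 0. 0 < 1 + u * t" by (rule order_tendstoD) simp
  have "((\<lambda>t. P - t * (c m * w m) / (1 + u * t)) \<longlongrightarrow> P - 0 * (c m * w m) / (1 + u * 0)) (at_right 0)"
    by (intro tendsto_intros) simp
  then have e2: "\<forall>\<^sub>F t in at_right 0. 0 < P - t * (c m * w m) / (1 + u * t)"
    by (rule order_tendstoD) (simp add: P)
  have e3: "\<forall>\<^sub>F t in at_right 0. 0 < (t::real)" by (simp add: eventually_at_right_less)
  obtain t where t: "0 < t" "0 < 1 + u * t" "0 < P - t * (c m * w m) / (1 + u * t)"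
    using eventually_happens'[OF _ eventually_conj[OF e1 eventually_conj[OF e2 e3]]]
    by (auto simp: trivial_limit_at_right_real)
  define x where "x = (\<lambda>i. if i = m then (1 + u * t) / w m else t)"
  have xm: "x m = (1 + u * t) / w m" and xo: "i \<noteq> m \<Longrightarrow> x i = t" for i
    by (auto simp: x_def)
  have wm: "0 < w m" using w_pos[OF m] .
  have "(\<Sum>i\<in>I. w i * x i) = (1 + u * t) + (\<Sum>i\<in>I - {m}. w i * t)"
    using wm by (simp add: remove xm xo cong: sum.cong_simp)
  also have "\<dots> = 1 + n * Tp * t" by (simp add: u_def algebra_simps sum_distrib_left)
  finally have feas: "feasible x t"
    using t wm by (auto simp: feasible_def x_def)
  have "G x t = d m * \<kappa> m * x m - t\<^sup>2 * c m / x m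
      + (\<Sum>i\<in>I - {m}. d i * \<kappa> i * t - t\<^sup>2 * c i / t) - 2 * n * t"
    by (simp add: G_def remove xo cong: sum.cong_simp)
  also have "(\<Sum>i\<in>I - {m}. d i * \<kappa> i * t - t\<^sup>2 * c i / t) = t * (\<Sum>i\<in>I - {m}. d i * \<kappa> i - c i)"
    using t(1) by (simp add: sum_distrib_left power2_eq_square algebra_simps)
  also have "d m * \<kappa> m * x m - t\<^sup>2 * c m / x m = L + t * (L * u) - t * (t * (c m * w m) / (1 + u * t))"
  proof -
    have "d m * \<kappa> m * x m = L * (1 + u * t)" using wm by (simp add: dk xm)
    then show ?thesis by (simp add: xm power2_eq_square algebra_simps)
  qed
  finally have "G x t = L + t * (P - t * (c m * w m) / (1 + u * t))"
    by (simp add: P_def algebra_simps)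
  then have "L < G x t" using t by simp
  with feas show ?thesis by blast
qed

text \<open>A single negative term is retained. Its index is free because it serves to keep that
  particular \<open>x j\<close> away from 0; discarding it as well leaves the bound used for small
  \<open>y\<close>.\<close>

lemma G_le:
  assumes "feasible x y" "j \<in> I"
  shows "G x y \<le> L * (1 + n * Tp * y) - y\<^sup>2 * c j / x j"
proof -
  have x: "0 < x i" if "i \<in> I" for i using assms that by (simp add: feasible_def)
  have y: "0 < y" using assms by (simp add: feasible_def)
  have "(\<Sum>i\<in>I. d i * \<kappa> i * x i) \<le> (\<Sum>i\<in>I. L * w i * x i)"
    using dk_le x by (intro sum_mono mult_right_mono) (auto simp: less_imp_le)
  also have "\<dots> = L * (1 + n * Tp * y)"
    using assms by (simp add: feasible_def mult.assoc flip: sum_distrib_left)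
  finally have 1: "(\<Sum>i\<in>I. d i * \<kappa> i * x i) \<le> L * (1 + n * Tp * y)" .
  have 2: "y\<^sup>2 * c j / x j \<le> (\<Sum>i\<in>I. y\<^sup>2 * c i / x i)"
    using c_pos x by (intro member_le_sum assms(2) fin) (auto simp: less_imp_le)
  have "0 < n * y" using n_pos y by simp
  with 1 2 show ?thesis by (simp add: G_def sum_subtractf)
qed

text \<open>Each summand of \<open>G\<close> increases with \<open>x i\<close>, so
  \<open>w i * x i\<close> may be replaced by the entire right-hand side
  \<open>1 + n * Tp * y\<close>. This gives \<open>G x y \<le> y * h (1 / y)\<close>, where
  \<open>h 0\<close> is the left side of \<open>cond2\<close>; continuity of \<open>h\<close> at 0
  then suffices.\<close>

lemma G_neg_for_large_y: "\<exists>Y>0. \<forall>x y. feasible x y \<longrightarrow> Y < y \<longrightarrow> G x y < 0"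
proof -
  define h where
    "h t = (\<Sum>i\<in>I. \<kappa> i / T i * (n * Tp + t) - c i * w i / (n * Tp + t)) - 2 * n" for t
  have nT: "0 < n * Tp" using n_pos Tp_pos by simp
  have "h 0 = (\<Sum>i\<in>I. (n\<^sup>2 * \<kappa> i * Tp\<^sup>2 - (d i)\<^sup>2 * (1 - \<kappa> i) * (T i)\<^sup>2) / (n * Tp * T i)) - 2 * n"
    unfolding h_def
  proof (intro arg_cong2[where f = minus] sum.cong refl)
    fix i assume "i \<in> I"
    then show "\<kappa> i / T i * (n * Tp + 0) - c i * w i / (n * Tp + 0)
      = (n\<^sup>2 * \<kappa> i * Tp\<^sup>2 - (d i)\<^sup>2 * (1 - \<kappa> i) * (T i)\<^sup>2) / (n * Tp * T i)"
      using n_pos Tp_pos T_pos[of i] by (simp add: c_def w_def divide_simps) (simp add: power2_eq_square algebra_simps)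
  qed
  then have h0: "h 0 < 0" using cond2 by simp
  have "(h \<longlongrightarrow> h 0) (at_right 0)"
    unfolding h_def using nT by (intro tendsto_intros) auto
  then have "\<forall>\<^sub>F t in at_right 0. h t < 0" using h0 by (rule order_tendstoD)
  then obtain b where b: "0 < b" "\<And>t. 0 < t \<Longrightarrow> t < b \<Longrightarrow> h t < 0"
    unfolding eventually_at_right_field by auto
  have "G x y < 0" if f: "feasible x y" and y: "1 / b < y" for x y
  proof -
    have x: "0 < x i" if "i \<in> I" for i using f that by (simp add: feasible_def)
    have y0: "0 < y" using f by (simp add: feasible_def)
    have "G x y \<le> (\<Sum>i\<in>I. y * (\<kappa> i / T i * (n * Tp + 1 / y) - c i * w i / (n * Tp + 1 / y))) - 2 * n * y"
      unfolding G_def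
    proof (intro diff_right_mono sum_mono)
      fix i assume i: "i \<in> I"
      have "w i * x i \<le> (\<Sum>i\<in>I. w i * x i)"
        using w_pos x by (intro member_le_sum i fin) (auto simp: less_imp_le)
      moreover have "y * (n * Tp + 1 / y) = 1 + n * Tp * y" using y0 by (simp add: field_simps)
      ultimately have wx: "w i * x i \<le> y * (n * Tp + 1 / y)"
        using f by (simp add: feasible_def)
      have k: "0 \<le> \<kappa> i / T i" using kappa_nonneg[OF i] T_pos[OF i] by simp
      have "d i * \<kappa> i * x i = \<kappa> i / T i * (w i * x i)"
        using T_pos[OF i] by (simp add: w_def)
      also have "\<dots> \<le> \<kappa> i / T i * (y * (n * Tp + 1 / y))" by (rule mult_left_mono[OF wx k])
      finally have 1: "d i * \<kappa> i * x i \<le> y * (\<kappa> i / T i * (n * Tp + 1 / y))" by (simp add: mult_ac)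
      have pos: "0 < w i * x i" "0 < w i" "0 < x i" "0 < c i"
        using w_pos[OF i] x[OF i] c_pos[OF i] by simp_all
      have "y * (c i * w i / (n * Tp + 1 / y)) = y\<^sup>2 * c i * w i / (y * (n * Tp + 1 / y))"
        using y0 by (simp add: power2_eq_square)
      also have "\<dots> \<le> y\<^sup>2 * c i * w i / (w i * x i)"
        by (rule divide_left_mono[OF wx]) (use pos y0 nT wx in \<open>auto intro!: mult_pos_pos add_pos_pos\<close>)
      also have "\<dots> = y\<^sup>2 * c i / x i" using pos by simp
      finally show "d i * \<kappa> i * x i - y\<^sup>2 * c i / x i
        \<le> y * (\<kappa> i / T i * (n * Tp + 1 / y) - c i * w i / (n * Tp + 1 / y))"
        using 1 by (simp add: right_diff_distrib)
    qed
    also have "\<dots> = y * h (1 / y)" by (simp add: h_def right_diff_distrib sum_distrib_left)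
    also have "\<dots> < 0"
      using b(2)[of "1 / y"] b(1) y y0 by (intro mult_pos_neg) (auto simp: field_simps)
    finally show ?thesis .
  qed
  then show ?thesis using b(1) by (intro exI[of _ "1 / b"]) auto
qed

theorem G_attains_max: "\<exists>x y. feasible x y \<and> (\<forall>x' y'. feasible x' y' \<longrightarrow> G x' y' \<le> G x y)"
proof -
  obtain xs ys where s: "feasible xs ys" "L < G xs ys" using exists_better_than_L by blast
  obtain Y where Y: "0 < Y" "\<And>x y. feasible x y \<Longrightarrow> Y < y \<Longrightarrow> G x y < 0"
    using G_neg_for_large_y by blast
  \<comment> \<open>Comes from solving \<open>G xs ys \<le> L + (L * n * Tp + 1) * y\<close> for
    \<open>y\<close>. The added 1 keeps the denominator positive when \<open>L = 0\<close>, and the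
    1 in \<open>M\<close> does the same there.\<close>
  define \<epsilon> where "\<epsilon> = (G xs ys - L) / (L * n * Tp + 1)"
  define M where "M = L * (1 + n * Tp * Y) + 1"
  have nT: "0 < n * Tp" using n_pos Tp_pos by simp
  have LnT: "0 \<le> L * n * Tp" using nT L_nonneg by (simp add: mult.assoc)
  have eps: "0 < \<epsilon>" using s LnT by (simp add: \<epsilon>_def)
  have M: "0 < M" using nT L_nonneg Y(1) by (simp add: M_def add_nonneg_pos)
  \<comment> \<open>For \<open>i \<in> I\<close>, the lower bound comes from \<open>G_le\<close>
    with \<open>j = i\<close>, the upper bound from the constraint with \<open>y \<le> Y\<close>.
    Below, \<open>y\<close> is eliminated through the constraint, so a point of \<open>D\<close> is
    feasible as soon as its coordinates in \<open>I\<close> are positive.\<close>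
  define lo where "lo i = (if i \<in> I then c i * \<epsilon>\<^sup>2 / M else 0)" for i
  define hi where "hi i = (if i \<in> I then (1 + n * Tp * Y) / w i else 0)" for i
  define y where "y x = ((\<Sum>i\<in>I. w i * x i) - 1) / (n * Tp)" for x
  define D where "D = {x. \<forall>i. lo i \<le> x i \<and> x i \<le> hi i} \<inter> {x. \<epsilon> \<le> y x}"
  have y_eq: "y x = b" if "feasible x b" for x b
    using that nT by (auto simp: y_def feasible_def)
  have bound: "(\<lambda>i. if i \<in> I then x i else 0) \<in> D" if f: "feasible x b" and G: "G xs ys \<le> G x b" for x b
  proof -
    have x: "0 < x i" if "i \<in> I" for i using f that by (simp add: feasible_def)
    have b0: "0 < b" using f by (simp add: feasible_def)
    \<comment> \<open>The competitor has value at least \<open>G xs ys\<close>, hence above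
      \<open>L \<ge> 0\<close>, whereas values beyond \<open>Y\<close> are negative.\<close>
    have bY: "b \<le> Y" using Y(2)[OF f] G s L_nonneg by (metis linorder_not_less less_trans not_less_iff_gr_or_eq order_less_le_trans)
    have "G x b \<le> L * (1 + n * Tp * b) - b\<^sup>2 * c m / x m" by (rule G_le[OF f m])
    also have "\<dots> \<le> L * (1 + n * Tp * b)" using c_pos[OF m] x[OF m] by simp
    also have "\<dots> \<le> L + (L * n * Tp + 1) * b" using b0 by (simp add: algebra_simps)
    finally have "G xs ys - L \<le> (L * n * Tp + 1) * b" using G by simp
    then have eb: "\<epsilon> \<le> b" using LnT by (simp add: \<epsilon>_def divide_le_eq mult.commute add_nonneg_pos)
    have "lo i \<le> x i \<and> x i \<le> hi i" if i: "i \<in> I" for i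
    proof
      have "\<epsilon>\<^sup>2 \<le> b\<^sup>2" using eb eps by (intro power_mono) auto
      then have "\<epsilon>\<^sup>2 * c i / x i \<le> b\<^sup>2 * c i / x i"
        using c_pos[OF i] x[OF i] by (intro divide_right_mono mult_right_mono) auto
      also have "\<dots> \<le> L * (1 + n * Tp * b) - G x b" using G_le[OF f i] by simp
      also have "\<dots> \<le> L * (1 + n * Tp * b)" using G s L_nonneg by simp
      also have "\<dots> \<le> L * (1 + n * Tp * Y)"
        using bY nT L_nonneg by (intro mult_left_mono add_left_mono) auto
      also have "\<dots> \<le> M" by (simp add: M_def)
      finally show "lo i \<le> x i" using x[OF i] M i by (simp add: lo_def field_simps)
      have "w i * x i \<le> (\<Sum>i\<in>I. w i * x i)"
        using w_pos x by (intro member_le_sum i fin) (auto simp: less_imp_le)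
      also have "\<dots> = 1 + n * Tp * b" using f by (simp add: feasible_def)
      also have "\<dots> \<le> 1 + n * Tp * Y" using bY nT by (intro add_left_mono mult_left_mono) auto
      finally show "x i \<le> hi i" using w_pos[OF i] i by (simp add: hi_def field_simps)
    qed
    moreover have "y (\<lambda>i. if i \<in> I then x i else 0) = b"
      using y_eq[OF f] by (simp add: y_def cong: sum.cong)
    ultimately show ?thesis using eb by (auto simp: D_def lo_def hi_def)
  qed
  have ycont: "continuous_on UNIV y"
    unfolding y_def using nT by (intro continuous_intros) auto
  have "compact D"
    unfolding D_def using ycont
    by (intro compact_Int_closed compact_box_fun closed_Collect_le continuous_on_const)
  moreover have "D \<noteq> {}" using bound[OF s(1)] by auto
  moreover have lo_pos: "x i > 0" if "x \<in> D" "i \<in> I" for x i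
  proof -
    have "0 < lo i" using that c_pos eps M by (simp add: lo_def)
    also have "lo i \<le> x i" using that by (simp add: D_def)
    finally show ?thesis .
  qed
  have "continuous_on D (\<lambda>x. G x (y x))"
    unfolding G_def using lo_pos
    by (intro continuous_intros continuous_on_subset[OF ycont] continuous_on_product_coordinates[THEN continuous_on_subset])
       (auto simp: less_imp_neq[symmetric])
  ultimately obtain x where x: "x \<in> D" "\<And>x'. x' \<in> D \<Longrightarrow> G x' (y x') \<le> G x (y x)"
    using continuous_attains_sup[of D "\<lambda>x. G x (y x)"] by blast
  have fx: "feasible x (y x)"
    using x(1) lo_pos nT eps by (auto simp: feasible_def D_def y_def)
  have main: "G x' b \<le> G x (y x)" if f: "feasible x' b" and G: "G xs ys \<le> G x' b" for x' b
  proof -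
    have "G (\<lambda>i. if i \<in> I then x' i else 0) (y (\<lambda>i. if i \<in> I then x' i else 0)) = G x' (y x')"
      by (simp add: G_def y_def cong: sum.cong)
    then show ?thesis using x(2)[OF bound[OF f G]] y_eq[OF f] by simp
  qed
  \<comment> \<open>Feasible points with value below \<open>G xs ys\<close> are covered by
    transitivity, as \<open>G xs ys\<close> is itself bounded by the maximum over
    \<open>D\<close>.\<close>
  have "G x' b \<le> G x (y x)" if "feasible x' b" for x' b
    using main[OF that] main[OF s(1)] by linarith
  with fx show ?thesis by blast
qed

corollary scal_attains_max:
  defines "F \<equiv> \<lambda>\<beta> \<alpha>. - n / (2 * \<beta>) + (\<Sum>i\<in>I. d i * \<kappa> i / (4 * \<alpha> i) - d i * (1 - \<kappa> i) * \<alpha> i / (4 * \<beta>\<^sup>2))"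
  defines "C \<equiv> \<lambda>\<beta> \<alpha>. 0 < \<beta> \<and> (\<forall>i\<in>I. 0 < \<alpha> i) \<and> - n * Tp / \<beta> + (\<Sum>i\<in>I. d i * T i / \<alpha> i) = 1"
  shows "\<exists>\<beta> \<alpha>. C \<beta> \<alpha> \<and> (\<forall>\<beta>' \<alpha>'. C \<beta>' \<alpha>' \<longrightarrow> F \<beta>' \<alpha>' \<le> F \<beta> \<alpha>)"
proof -
  have C: "C \<beta> \<alpha> \<longleftrightarrow> feasible (\<lambda>i. 1 / \<alpha> i) (1 / \<beta>)" for \<beta> \<alpha>
    by (auto simp: C_def feasible_def w_def)
  have F: "F \<beta> \<alpha> = G (\<lambda>i. 1 / \<alpha> i) (1 / \<beta>) / 4" for \<beta> \<alpha>
    by (simp add: F_def G_def c_def diff_divide_distrib sum_divide_distrib power_divide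
        sum_subtractf sum.distrib mult_ac)
  obtain x y where xy: "feasible x y" "\<And>x' y'. feasible x' y' \<Longrightarrow> G x' y' \<le> G x y"
    using G_attains_max by blast
  then have "C (1 / y) (\<lambda>i. 1 / x i)" "F (1 / y) (\<lambda>i. 1 / x i) = G x y / 4"
    by (simp_all add: C F)
  then show ?thesis using xy(2) C F by (metis divide_right_mono zero_le_numeral)
qed

end

section \<open>Lie algebras with a Cartan involution\<close>

text \<open>An auxiliary inner product unrelated to the Killing form: traces have to be manipulated
  before \<open>Qform\<close> is known to be positive definite.\<close>

interpretation euclid: inner_form "inner :: 'g::euclidean_space \<Rightarrow> 'g \<Rightarrow> real"
proof
  show "bilinear (inner :: 'g \<Rightarrow> 'g \<Rightarrow> real)"
    unfolding bilinear_def by (auto intro!: linearI simp: inner_add_left inner_add_right)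
qed (auto simp: inner_commute)

lemma euclid_onb_Basis: "euclid.onb_on UNIV Basis"
  by (auto simp: euclid.onb_on_def inner_Basis)

lemma trace_eq_Basis: "linear f \<Longrightarrow> trace_on UNIV f = (\<Sum>e\<in>Basis. f e \<bullet> e)"
  by (rule euclid.trace_on_eq[OF euclid_onb_Basis]) auto

lemma trace_commute:
  fixes f h :: "'g::euclidean_space \<Rightarrow> 'g"
  assumes f: "linear f" and h: "linear h"
  shows "trace_on UNIV (\<lambda>x. f (h x)) = trace_on UNIV (\<lambda>x. h (f x))"
proof -
  have expand: "(\<Sum>e\<in>Basis. f' (h' e) \<bullet> e) = (\<Sum>e\<in>Basis. \<Sum>b\<in>Basis. (h' e \<bullet> b) * (f' b \<bullet> e))"
    if "linear f'" for f' h' :: "'g \<Rightarrow> 'g"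
  proof (rule sum.cong[OF refl])
    fix e :: 'g
    have "f' (h' e) = f' (\<Sum>b\<in>Basis. (h' e \<bullet> b) *\<^sub>R b)" by (simp add: euclidean_representation)
    then show "f' (h' e) \<bullet> e = (\<Sum>b\<in>Basis. (h' e \<bullet> b) * (f' b \<bullet> e))"
      by (simp add: linear_sum[OF that] linear_scale[OF that] inner_sum_left)
  qed
  have "trace_on UNIV (\<lambda>x. f (h x)) = (\<Sum>e\<in>Basis. f (h e) \<bullet> e)"
    using trace_eq_Basis[of "\<lambda>x. f (h x)"] linear_compose[OF h f] by (simp add: o_def)
  also have "\<dots> = (\<Sum>e\<in>Basis. h (f e) \<bullet> e)"
    unfolding expand[OF f] expand[OF h] by (subst sum.swap) (simp add: mult.commute)
  also have "\<dots> = trace_on UNIV (\<lambda>x. h (f x))"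
    using trace_eq_Basis[of "\<lambda>x. h (f x)"] linear_compose[OF f h] by (simp add: o_def)
  finally show ?thesis .
qed

lemma trace_diff:
  assumes "linear f" "linear h"
  shows "trace_on UNIV (\<lambda>x. f x - h x) = trace_on UNIV f - trace_on UNIV h"
  using assms linear_compose_sub[OF assms]
  by (simp add: trace_eq_Basis inner_diff_left sum_subtractf)

locale cartan_lie_algebra =
  fixes br :: "'g::euclidean_space \<Rightarrow> 'g \<Rightarrow> 'g" and \<theta> :: "'g \<Rightarrow> 'g"
  assumes lie: "lie_bracket br" and cartan: "cartan_involution br \<theta>"
begin

sublocale std: metric_lie_algebra "inner :: 'g \<Rightarrow> 'g \<Rightarrow> real" br
  by unfold_locales (rule lie)

lemmas br_simps = std.br_simps and br_skew = std.br_skew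

lemma linear_br: "linear (br X)" by (rule std.linear_br)

lemma jacobi: "br (br X Y) Z = br X (br Y Z) - br Y (br X Z)"
proof -
  have "br X (br Y Z) + br Y (br Z X) + br Z (br X Y) = 0"
    using lie unfolding lie_bracket_def by blast
  moreover have "br Z X = - br X Z" "br Z (br X Y) = - br (br X Y) Z" by (rule br_skew)+
  ultimately show ?thesis by (simp add: br_simps algebra_simps)
qed

lemma linear_theta: "linear \<theta>"
  and theta_theta: "\<theta> (\<theta> X) = X"
  and theta_br: "\<theta> (br X Y) = br (\<theta> X) (\<theta> Y)"
  and killing_theta_neg: "X \<noteq> 0 \<Longrightarrow> killing br X (\<theta> X) < 0"
  using cartan unfolding cartan_involution_def by blast+

lemmas theta_simps = linear_add[OF linear_theta] linear_diff[OF linear_theta]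
  linear_scale[OF linear_theta] linear_0[OF linear_theta] linear_neg[OF linear_theta]

lemma linear_br_br: "linear (\<lambda>Z. br X (br Y Z))"
  using linear_compose[OF linear_br linear_br] by (simp add: o_def)

lemma killing_trace: "killing br X Y = trace_on UNIV (\<lambda>Z. br X (br Y Z))"
  by (simp add: killing_def killing_on_def)

lemma bilinear_killing: "bilinear (killing br)"
proof -
  have "killing br X Y = (\<Sum>e\<in>Basis. br X (br Y e) \<bullet> e)" for X Y
    unfolding killing_trace by (rule trace_eq_Basis[OF linear_br_br])
  then show ?thesis
    unfolding bilinear_def
    by (auto intro!: linearI simp: br_simps inner_add_left sum.distrib sum_distrib_left)
qed

lemmas killing_simps =
  bilinear_ladd[OF bilinear_killing] bilinear_radd[OF bilinear_killing]
  bilinear_lmul[OF bilinear_killing] bilinear_rmul[OF bilinear_killing]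
  bilinear_lneg[OF bilinear_killing] bilinear_rneg[OF bilinear_killing]
  bilinear_lsub[OF bilinear_killing] bilinear_rsub[OF bilinear_killing]
  bilinear_lzero[OF bilinear_killing] bilinear_rzero[OF bilinear_killing]

lemma killing_sym: "killing br X Y = killing br Y X"
  unfolding killing_trace by (rule trace_commute[OF linear_br linear_br])

text \<open>By Jacobi both sides are traces of differences of triple products of ad X, ad Y and ad
  Z; the first products agree and the second differ by a cyclic shift.\<close>

lemma killing_ad: "killing br (br X Y) Z = killing br X (br Y Z)"
proof -
  have l3: "linear (\<lambda>W. br A (br B (br C W)))" for A B C
    using linear_compose[OF linear_br_br linear_br] by (simp add: o_def)
  have "killing br (br X Y) Z = trace_on UNIV (\<lambda>W. br X (br Y (br Z W)) - br Y (br X (br Z W)))"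
    unfolding killing_trace by (simp add: jacobi)
  also have "\<dots> = trace_on UNIV (\<lambda>W. br X (br Y (br Z W))) - trace_on UNIV (\<lambda>W. br Y (br X (br Z W)))"
    by (rule trace_diff[OF l3 l3])
  also have "trace_on UNIV (\<lambda>W. br Y (br X (br Z W))) = trace_on UNIV (\<lambda>W. br X (br Z (br Y W)))"
    by (rule trace_commute[OF linear_br linear_br_br])
  also have "trace_on UNIV (\<lambda>W. br X (br Y (br Z W))) - trace_on UNIV (\<lambda>W. br X (br Z (br Y W)))
     = trace_on UNIV (\<lambda>W. br X (br Y (br Z W)) - br X (br Z (br Y W)))"
    by (rule trace_diff[OF l3 l3, symmetric])
  also have "\<dots> = killing br X (br Y Z)"
    unfolding killing_trace by (simp add: jacobi br_simps)
  finally show ?thesis .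
qed

lemma theta_conj_trace:
  assumes "linear f" shows "trace_on UNIV (\<lambda>W. \<theta> (f (\<theta> W))) = trace_on UNIV f"
proof -
  have "linear (\<lambda>W. f (\<theta> W))" using linear_compose[OF linear_theta assms] by (simp add: o_def)
  from trace_commute[OF linear_theta this] show ?thesis by (simp add: theta_theta)
qed

lemma killing_theta: "killing br (\<theta> X) (\<theta> Y) = killing br X Y"
  using theta_conj_trace[OF linear_br_br[of X Y]] by (simp add: killing_trace theta_br theta_theta)

lemma killing_theta_move: "killing br (\<theta> X) Y = killing br X (\<theta> Y)"
  using killing_theta[of X "\<theta> Y"] by (simp add: theta_theta)

text \<open>The familiar form of the inner product: \<open>\<theta>\<close> preserves the Killing
  form, so the cross terms of the two projections cancel. Positivity is then the defining property
  of a Cartan involution.\<close>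

lemma Qform_eq: "Qform br \<theta> X Y = - killing br X (\<theta> Y)"
  using killing_theta[of X Y] killing_theta_move[of X Y]
  unfolding Qform_def pproj_def kproj_def by (simp add: killing_simps algebra_simps)

abbreviation q :: "'g \<Rightarrow> 'g \<Rightarrow> real" where "q \<equiv> Qform br \<theta>"

sublocale Q: inner_form q
proof
  show "bilinear q"
    unfolding bilinear_def
    by (auto intro!: linearI simp: Qform_eq killing_simps theta_simps)
  show "q X Y = q Y X" for X Y
    using killing_theta_move[of X Y] killing_sym[of "\<theta> X" Y] by (simp add: Qform_eq)
  show "X \<noteq> 0 \<Longrightarrow> 0 < q X X" for X
    using killing_theta_neg by (simp add: Qform_eq)
qed

text \<open>The \<open>q\<close>-adjoint of ad X is minus ad of \<open>\<theta> X\<close>: skew for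
  \<open>X\<close> in k, symmetric for \<open>X\<close> in p. Nearly all later invariance arguments
  rest on this.\<close>

lemma q_ad: "q (br X Y) Z = - q Y (br (\<theta> X) Z)"
proof -
  have "killing br (br X Y) (\<theta> Z) = - killing br (br Y X) (\<theta> Z)"
    by (subst br_skew) (simp add: killing_simps)
  also have "killing br (br Y X) (\<theta> Z) = killing br Y (br X (\<theta> Z))" by (rule killing_ad)
  also have "br X (\<theta> Z) = \<theta> (br (\<theta> X) Z)" by (simp add: theta_br theta_theta)
  finally show ?thesis by (simp add: Qform_eq)
qed

text \<open>Conjugation by \<open>\<theta>\<close> shows that ad Z and ad of
  \<open>\<theta> Z\<close> have equal traces, and the adjoint formula \<open>q_ad\<close> shows
  that the traces are opposite.\<close>

lemma trace_ad: "trace_on UNIV (br Z) = 0"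
proof -
  obtain E where E: "Q.onb_on UNIV E" using Q.exists_onb_on[of UNIV] by auto
  have tr: "trace_on UNIV (br Z) = (\<Sum>e\<in>E. q (br Z e) e)" for Z
    by (rule Q.trace_on_eq[OF E linear_br]) simp
  have "trace_on UNIV (br (\<theta> Z)) = trace_on UNIV (br Z)"
    using theta_conj_trace[OF linear_br[of Z]] by (simp add: theta_br theta_theta)
  moreover have "trace_on UNIV (br Z) = - trace_on UNIV (br (\<theta> Z))"
    unfolding tr by (simp add: q_ad[of Z] Q.sym[of _ "br (\<theta> Z) _"] sum_negf)
  ultimately show ?thesis by simp
qed

lemma subspace_kspace: "subspace (kspace \<theta>)"
  by (auto simp: subspace_def kspace_def theta_simps)

text \<open>If \<open>X\<close> is orthogonal to k, then \<open>Y = X + \<theta> X\<close> lies in k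
  and its Killing square is twice the product of \<open>X\<close> with \<open>Y\<close>, which
  vanishes; so \<open>q Y Y = 0\<close>.\<close>

lemma pspace_eq: "pspace br \<theta> = {X. \<theta> X = - X}"
proof (intro set_eqI iffI)
  fix X assume X: "X \<in> pspace br \<theta>"
  define Y where "Y = X + \<theta> X"
  have "Y \<in> kspace \<theta>" by (simp add: Y_def kspace_def theta_simps theta_theta)
  then have "\<theta> Y = Y" "killing br X Y = 0" using X by (auto simp: kspace_def pspace_def)
  moreover have "killing br (\<theta> X) Y = killing br X (\<theta> Y)" by (rule killing_theta_move)
  ultimately have "q Y Y = 0" by (simp add: Qform_eq) (simp add: Y_def killing_simps)
  then have "Y = 0" by (simp add: Q.q_eq_0_iff)
  then show "X \<in> {X. \<theta> X = - X}" by (simp add: Y_def eq_neg_iff_add_eq_0 add.commute)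
next
  fix X assume X: "X \<in> {X. \<theta> X = - X}"
  show "X \<in> pspace br \<theta>"
    unfolding pspace_def
  proof (intro CollectI ballI)
    fix Y assume "Y \<in> kspace \<theta>"
    then show "killing br X Y = 0"
      using X killing_theta[of X Y] by (simp add: kspace_def killing_simps)
  qed
qed

lemma theta_k: "X \<in> kspace \<theta> \<Longrightarrow> \<theta> X = X" and theta_p: "X \<in> pspace br \<theta> \<Longrightarrow> \<theta> X = - X"
  by (auto simp: kspace_def pspace_eq)

lemma subspace_pspace: "subspace (pspace br \<theta>)"
  by (auto simp: subspace_def pspace_eq theta_simps)

lemma br_kk: "X \<in> kspace \<theta> \<Longrightarrow> Y \<in> kspace \<theta> \<Longrightarrow> br X Y \<in> kspace \<theta>"
  and br_kp: "X \<in> kspace \<theta> \<Longrightarrow> Y \<in> pspace br \<theta> \<Longrightarrow> br X Y \<in> pspace br \<theta>"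
  and br_pp: "X \<in> pspace br \<theta> \<Longrightarrow> Y \<in> pspace br \<theta> \<Longrightarrow> br X Y \<in> kspace \<theta>"
  by (auto simp: kspace_def pspace_eq theta_br br_simps)

lemma q_kp: "X \<in> kspace \<theta> \<Longrightarrow> Y \<in> pspace br \<theta> \<Longrightarrow> q X Y = 0"
  by (simp add: Qform_eq theta_p killing_simps killing_sym[of X Y]) (simp add: pspace_def)

lemma killing_k: "X \<in> kspace \<theta> \<Longrightarrow> killing br Y X = - q Y X"
  and killing_p: "X \<in> pspace br \<theta> \<Longrightarrow> killing br Y X = q Y X"
  by (simp_all add: Qform_eq theta_k theta_p killing_simps)

lemma kproj_in: "kproj \<theta> X \<in> kspace \<theta>" and pproj_in: "pproj \<theta> X \<in> pspace br \<theta>"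
  by (simp_all add: kproj_def pproj_def kspace_def pspace_eq theta_simps theta_theta add.commute
      scaleR_right_diff_distrib)

lemma kproj_pproj: "kproj \<theta> X + pproj \<theta> X = X"
  by (simp add: kproj_def pproj_def algebra_simps flip: scaleR_2 scaleR_left_distrib)

lemma q_ad_k: "X \<in> kspace \<theta> \<Longrightarrow> q (br X Y) Z = - q Y (br X Z)"
  using q_ad[of X Y Z] by (simp add: theta_k)

lemma derived_k: "derived br (kspace \<theta>) \<subseteq> kspace \<theta>"
  unfolding derived_def by (rule span_minimal[OF _ subspace_kspace]) (auto intro: br_kk)

lemma subspace_derived: "subspace (derived br A)"
  by (simp add: derived_def)

lemma br_in_derived: "X \<in> A \<Longrightarrow> Y \<in> A \<Longrightarrow> br X Y \<in> derived br A"
  unfolding derived_def by (auto intro: span_base)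

lemma centre_orth_derived:
  assumes c: "c \<in> centre br (kspace \<theta>)" and x: "x \<in> derived br (kspace \<theta>)"
  shows "q c x = 0"
  using x unfolding derived_def
proof (induction rule: span_induct_alt)
  case base
  then show ?case by (simp add: Q.q_simps)
next
  case (step a x y)
  then obtain X Y where XY: "x = br X Y" "X \<in> kspace \<theta>" "Y \<in> kspace \<theta>" by blast
  have "br c X = 0" using c XY by (auto simp: centre_def)
  then have "br X c = 0" using br_skew[of X c] by simp
  then have "q x c = 0" using q_ad_k[OF XY(2), of Y c] XY(1) by (simp add: Q.q_simps)
  then show ?case using step by (simp add: Q.q_simps Q.sym[of c x])
qed

text \<open>With \<open>u = br Y v\<close>, skewness of ad Y gives
  \<open>q u u = - q v (br Y u)\<close>, and \<open>br Y u\<close> is in the derived algebra. This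
  yields the splitting of k into centre and derived algebra directly.\<close>

lemma orth_derived_central:
  assumes v: "v \<in> kspace \<theta>" and o: "\<And>x. x \<in> derived br (kspace \<theta>) \<Longrightarrow> q v x = 0"
  shows "v \<in> centre br (kspace \<theta>)"
  unfolding centre_def
proof (intro CollectI conjI ballI v)
  fix Y assume Y: "Y \<in> kspace \<theta>"
  define u where "u = br Y v"
  have "u \<in> kspace \<theta>" using br_kk Y v by (simp add: u_def)
  then have "q v (br Y u) = 0" using o br_in_derived Y by blast
  then have "q u u = 0" using q_ad_k[OF Y, of v u] by (simp add: u_def)
  then have "u = 0" by (simp add: Q.q_eq_0_iff)
  then show "br v Y = 0" using br_skew[of v Y] by (simp add: u_def)
qed

lemma kspace_decomp:
  assumes "v \<in> kspace \<theta>"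
  obtains c x where "c \<in> centre br (kspace \<theta>)" "x \<in> derived br (kspace \<theta>)" "v = c + x"
proof -
  obtain E where E: "Q.onb_on (derived br (kspace \<theta>)) E"
    using Q.exists_onb_on[OF subspace_derived] by blast
  define x where "x = (\<Sum>e\<in>E. q v e *\<^sub>R e)"
  have x: "x \<in> derived br (kspace \<theta>)"
    unfolding x_def using Q.onb_on_mem[OF E] subspace_derived
    by (intro subspace_sum subspace_scale) auto
  have "q (v - x) y = 0" if "y \<in> derived br (kspace \<theta>)" for y
  proof -
    have "q (v - x) e = 0" if "e \<in> E" for e
      using Q.q_sum_onb[OF E that, of "q v"] by (simp add: x_def Q.q_simps)
    then have "q (v - x) (\<Sum>e\<in>E. q y e *\<^sub>R e) = 0" by (simp add: Q.q_simps(4,12))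
    then show ?thesis using Q.onb_expand[OF E that] by simp
  qed
  moreover have "v - x \<in> kspace \<theta>"
    using assms x derived_k subspace_kspace by (intro subspace_diff) auto
  ultimately have "v - x \<in> centre br (kspace \<theta>)" by (intro orth_derived_central) auto
  with x show ?thesis by (intro that[of "v - x" x]) auto
qed

end

section \<open>Decomposition of a simple Lie algebra and scalar curvature of the metrics\<close>

locale simple_cartan_decomposition = cartan_lie_algebra br \<theta>
  for br :: "'g::euclidean_space \<Rightarrow> 'g \<Rightarrow> 'g" and \<theta> :: "'g \<Rightarrow> 'g" +
  fixes kk :: "nat \<Rightarrow> 'g set" and r s :: nat and \<kappa> :: "nat \<Rightarrow> real"
  assumes simple: "simple_alg br UNIV"
    and noncompact: "\<not> (\<forall>X. X \<noteq> 0 \<longrightarrow> killing br X X < 0)"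
    and s_def: "s = (if centre br (kspace \<theta>) = {0} then 0 else 1)"
    and kk_simple: "\<forall>i\<in>{1..r}. simple_alg br (kk i) \<and> ideal_in br (kk i) (derived br (kspace \<theta>))"
    and kk_disj: "\<forall>i\<in>{1..r}. \<forall>j\<in>{1..r}. i \<noteq> j \<longrightarrow> kk i \<inter> kk j = {0}"
    and kk_span: "span (\<Union>i\<in>{1..r}. kk i) = derived br (kspace \<theta>)"
    and kk_centre: "s = 1 \<longrightarrow> kk (r + 1) = centre br (kspace \<theta>)"
    and kappa: "\<forall>i\<in>{1..r+s}. \<forall>X\<in>kk i. \<forall>Y\<in>kk i.
                   killing_on br (kk i) X Y = \<kappa> i * killing br X Y"
begin

lemma index_cases:
  assumes "i \<in> {1..r+s}"
  obtains "i \<in> {1..r}" | "i = r + 1" "s = 1" "kk i = centre br (kspace \<theta>)"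
proof (cases "i \<le> r")
  case True
  then show ?thesis using assms that(1) by simp
next
  case False
  then have "s = 1" "i = r + 1" using assms by (auto simp: s_def split: if_splits)
  then show ?thesis using kk_centre that(2) by simp
qed

lemma subspace_centre: "subspace (centre br (kspace \<theta>))"
  using subspace_kspace by (auto simp: subspace_def centre_def br_simps)

text \<open>Perfectness, the third claim, holds because the derived algebra of a simple algebra is a
  nonzero ideal. It is what later makes distinct summands orthogonal.\<close>

lemma simple_ideal:
  assumes "i \<in> {1..r}"
  shows "subspace (kk i)" "kk i \<subseteq> derived br (kspace \<theta>)" "kk i = derived br (kk i)"
    "X \<in> derived br (kspace \<theta>) \<Longrightarrow> Y \<in> kk i \<Longrightarrow> br X Y \<in> kk i"
proof -
  have s: "simple_alg br (kk i)" and ideal: "ideal_in br (kk i) (derived br (kspace \<theta>))"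
    using kk_simple assms by auto
  show sub: "subspace (kk i)" and "kk i \<subseteq> derived br (kspace \<theta>)"
    and "X \<in> derived br (kspace \<theta>) \<Longrightarrow> Y \<in> kk i \<Longrightarrow> br X Y \<in> kk i"
    using ideal by (auto simp: ideal_in_def)
  have cl: "br X Y \<in> kk i" if "X \<in> kk i" "Y \<in> kk i" for X Y
    using s that by (auto simp: simple_alg_def subalgebra_def)
  have "derived br (kk i) \<subseteq> kk i"
    unfolding derived_def by (rule span_minimal[OF _ sub]) (auto intro: cl)
  then have "ideal_in br (derived br (kk i)) (kk i)"
    using br_in_derived[of _ "kk i"] by (auto simp: ideal_in_def subspace_derived)
  moreover have "derived br (kk i) \<noteq> {0}"
    using s br_in_derived[of _ "kk i"] by (force simp: simple_alg_def)
  ultimately show "kk i = derived br (kk i)" using s by (auto simp: simple_alg_def)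
qed

lemma kk_subspace: "i \<in> {1..r+s} \<Longrightarrow> subspace (kk i)"
  by (erule index_cases) (simp_all add: simple_ideal(1) subspace_centre)

lemma kk_sub_k: "i \<in> {1..r+s} \<Longrightarrow> kk i \<subseteq> kspace \<theta>"
  by (erule index_cases) (use simple_ideal(2) derived_k in \<open>blast, auto simp: centre_def\<close>)

lemma kk_nonzero: "i \<in> {1..r+s} \<Longrightarrow> kk i \<noteq> {0}"
proof (erule index_cases)
  assume "i \<in> {1..r}"
  then obtain X Y where "X \<in> kk i" "Y \<in> kk i" "br X Y \<noteq> 0"
    using kk_simple unfolding simple_alg_def by blast
  then have "X \<noteq> 0" by (auto simp: br_simps)
  with \<open>X \<in> kk i\<close> show "kk i \<noteq> {0}" by blast
qed (auto simp: s_def split: if_splits)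

text \<open>The bracket of two ideals lies in both, and simple summands meet only in 0; the
  remaining summand is central in k.\<close>

lemma kk_commute:
  assumes "i \<in> {1..r+s}" "j \<in> {1..r+s}" "i \<noteq> j" "X \<in> kk i" "Y \<in> kk j"
  shows "br X Y = 0"
  using assms(1)
proof (cases rule: index_cases)
  case 1
  show ?thesis using assms(2)
  proof (cases rule: index_cases)
    case j: 1
    have "br X Y \<in> kk j" using simple_ideal(2,4)[OF j] simple_ideal(2,4)[OF 1] assms by blast
    moreover have "br Y X \<in> kk i" using simple_ideal(2,4)[OF j] simple_ideal(2,4)[OF 1] assms by blast
    then have "br X Y \<in> kk i"
      using br_skew[of X Y] simple_ideal(1)[OF 1] by (simp add: subspace_neg)
    ultimately show ?thesis using kk_disj 1 j assms(3) by blast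
  next
    case 2
    then have "br Y X = 0" using assms kk_sub_k by (auto simp: centre_def)
    then show ?thesis using br_skew[of X Y] by simp
  qed
next
  case 2
  then show ?thesis using assms kk_sub_k[OF assms(2)] by (auto simp: centre_def)
qed

lemma kk_closed:
  assumes "i \<in> {1..r+s}" "X \<in> kk i" "Y \<in> kk i"
  shows "br X Y \<in> kk i"
  using assms(1)
proof (cases rule: index_cases)
  case 1
  then show ?thesis using simple_ideal(2,4) assms by blast
next
  case 2
  then have "br X Y = 0" using assms kk_sub_k[OF assms(1)] by (auto simp: centre_def)
  then show ?thesis using kk_subspace[OF assms(1)] by (simp add: subspace_0)
qed

text \<open>A simple summand is spanned by brackets \<open>br A B\<close> of its own elements, and
  \<open>q (br A B) Y = - q B (br A Y) = 0\<close> because \<open>A\<close> commutes with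
  \<open>Y\<close>.\<close>

lemma kk_orth:
  assumes "i \<in> {1..r+s}" "j \<in> {1..r+s}" "i \<noteq> j" "X \<in> kk i" "Y \<in> kk j"
  shows "q X Y = 0"
  using assms(1)
proof (cases rule: index_cases)
  case 1
  have "X \<in> derived br (kk i)" using simple_ideal(3)[OF 1] assms by simp
  then show ?thesis unfolding derived_def
  proof (induction rule: span_induct_alt)
    case base
    then show ?case by (simp add: Q.q_simps)
  next
    case (step c x y)
    then obtain A B where AB: "x = br A B" "A \<in> kk i" "B \<in> kk i" by blast
    have "br A Y = 0" using kk_commute assms AB by blast
    moreover have "A \<in> kspace \<theta>" using kk_sub_k assms AB by blast
    ultimately have "q x Y = 0" using q_ad_k[of A B Y] AB by (simp add: Q.q_simps)
    then show ?case using step by (simp add: Q.q_simps)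
  qed
next
  case 2
  then have "j \<in> {1..r}" using assms(2,3) by auto
  then have "Y \<in> derived br (kspace \<theta>)" using simple_ideal(2) assms by blast
  then show ?thesis using centre_orth_derived 2 assms by simp
qed

text \<open>Index 0 is given to p, so that \<open>\<beta>\<close> and the \<open>\<alpha>\<close> of
  a metric merge into one family of coefficients.\<close>

definition V :: "nat \<Rightarrow> 'g set" where
  "V i = (if i = 0 then pspace br \<theta> else kk i)"

definition E :: "nat \<Rightarrow> 'g set" where
  "E i = (SOME e. Q.onb_on (V i) e)"

lemma V_0: "V 0 = pspace br \<theta>" and V_pos: "i \<in> {1..r+s} \<Longrightarrow> V i = kk i"
  by (simp_all add: V_def)

lemma index_split: "{0..r+s} = insert 0 {1..r+s}"
  by auto

lemma span_V: "span (\<Union>i\<in>{0..r+s}. V i) = UNIV"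
proof -
  let ?W = "span (\<Union>i\<in>{0..r+s}. V i)"
  have "V i \<subseteq> ?W" if "i \<in> {0..r+s}" for i
    using that span_superset[of "\<Union>i\<in>{0..r+s}. V i"] by blast
  then have p: "pspace br \<theta> \<subseteq> ?W" and k: "i \<in> {1..r+s} \<Longrightarrow> kk i \<subseteq> ?W" for i
    using V_0 V_pos by (fastforce, fastforce)
  have "(\<Union>i\<in>{1..r}. kk i) \<subseteq> ?W" using k by fastforce
  then have d: "derived br (kspace \<theta>) \<subseteq> ?W"
    unfolding kk_span[symmetric] by (rule span_minimal) simp
  have c: "centre br (kspace \<theta>) \<subseteq> ?W"
  proof (cases "s = 0")
    case True
    then have "centre br (kspace \<theta>) = {0}" by (auto simp: s_def split: if_splits)
    then show ?thesis by (simp add: span_zero)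
  next
    case False
    then have "s = 1" by (auto simp: s_def split: if_splits)
    then show ?thesis using k[of "r + 1"] kk_centre by simp
  qed
  have "X \<in> ?W" for X
  proof -
    obtain a x where ax: "a \<in> centre br (kspace \<theta>)" "x \<in> derived br (kspace \<theta>)" "kproj \<theta> X = a + x"
      using kspace_decomp[OF kproj_in] by blast
    have "X = (a + x) + pproj \<theta> X" using kproj_pproj[of X] ax by simp
    also have "\<dots> \<in> ?W" using ax c d p pproj_in[of X] by (intro span_add) auto
    finally show ?thesis .
  qed
  then show ?thesis by blast
qed

sublocale D: orthogonal_decomposition q "{0..r+s}" V E
proof
  show "finite {0..r+s}" by simp
  show "Q.onb_on (V i) (E i)" if "i \<in> {0..r+s}" for i
  proof -
    have "subspace (V i)" using that kk_subspace subspace_pspace by (auto simp: V_def)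
    then show ?thesis unfolding E_def by (rule someI_ex[OF Q.exists_onb_on])
  qed
  show "q x y = 0" if ij: "i \<in> {0..r+s}" "j \<in> {0..r+s}" "i \<noteq> j" and xy: "x \<in> V i" "y \<in> V j" for i j x y
  proof -
    consider "i = 0" "j \<in> {1..r+s}" | "j = 0" "i \<in> {1..r+s}" | "i \<in> {1..r+s}" "j \<in> {1..r+s}"
      using ij by fastforce
    then show ?thesis
    proof cases
      case 1
      then have "q y x = 0" using xy kk_sub_k[of j] q_kp by (auto simp: V_def)
      then show ?thesis by (simp add: Q.sym)
    next
      case 2
      then show ?thesis using xy kk_sub_k[of i] q_kp by (auto simp: V_def)
    next
      case 3
      then show ?thesis using kk_orth ij xy by (auto simp: V_def)
    qed
  qed
  show "span (\<Union>i\<in>{0..r+s}. V i) = UNIV" by (rule span_V)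
qed

lemma theta_V: "i \<in> {0..r+s} \<Longrightarrow> X \<in> V i \<Longrightarrow> \<theta> X = X \<or> \<theta> X = - X"
  using theta_p theta_k kk_sub_k[of i] by (cases "i = 0") (auto simp: V_def)

text \<open>The Wang--Ziller symbols \<open>[ijl]\<close> of the decomposition.\<close>
definition A :: "nat \<Rightarrow> nat \<Rightarrow> nat \<Rightarrow> real" where
  "A i j l = (\<Sum>e\<in>E i. \<Sum>f\<in>E j. \<Sum>h\<in>E l. (q (br e f) h)\<^sup>2)"

lemma sum_blocks:
  "(\<Sum>e\<in>E i. \<Sum>j\<in>J. \<Sum>f\<in>E j. \<Sum>l\<in>L. \<Sum>h\<in>E l. w j l * (q (br e f) h)\<^sup>2)
    = (\<Sum>j\<in>J. \<Sum>l\<in>L. w j l * A i j l)"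
proof -
  have "(\<Sum>e\<in>E i. \<Sum>f\<in>E j. \<Sum>l\<in>L. \<Sum>h\<in>E l. w j l * (q (br e f) h)\<^sup>2)
    = (\<Sum>l\<in>L. w j l * A i j l)" for j
  proof -
    have "(\<Sum>f\<in>E j. \<Sum>l\<in>L. \<Sum>h\<in>E l. w j l * (q (br e f) h)\<^sup>2)
      = (\<Sum>l\<in>L. \<Sum>f\<in>E j. \<Sum>h\<in>E l. w j l * (q (br e f) h)\<^sup>2)" for e
      by (rule sum.swap)
    then have "(\<Sum>e\<in>E i. \<Sum>f\<in>E j. \<Sum>l\<in>L. \<Sum>h\<in>E l. w j l * (q (br e f) h)\<^sup>2)
      = (\<Sum>l\<in>L. \<Sum>e\<in>E i. \<Sum>f\<in>E j. \<Sum>h\<in>E l. w j l * (q (br e f) h)\<^sup>2)"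
      by (simp only: sum.swap[of _ L "E i"])
    then show ?thesis by (simp add: A_def sum_distrib_left)
  qed
  then show ?thesis by (subst sum.swap) simp
qed

section \<open>Symmetry, vanishing and values of the symbols, and the resulting dimension
  identity\<close>

lemma A_swap12: "A i j l = A j i l"
proof -
  have "(q (br e f) h)\<^sup>2 = (q (br f e) h)\<^sup>2" for e f h
    by (subst br_skew) (simp add: Q.q_simps)
  then show ?thesis unfolding A_def by (subst sum.swap) simp
qed

text \<open>Each \<open>e\<close> is an eigenvector of \<open>\<theta>\<close>, so ad e is symmetric
  or skew for \<open>q\<close>; squaring hides the sign.\<close>

lemma A_swap23:
  assumes "i \<in> {0..r+s}" shows "A i j l = A i l j"
proof -
  have "(\<Sum>f\<in>E j. \<Sum>h\<in>E l. (q (br e f) h)\<^sup>2) = (\<Sum>h\<in>E l. \<Sum>f\<in>E j. (q (br e h) f)\<^sup>2)"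
    if "e \<in> E i" for e
  proof -
    have "\<theta> e = e \<or> \<theta> e = - e" using theta_V assms D.E_in_V that by blast
    then have "(q (br e f) h)\<^sup>2 = (q (br e h) f)\<^sup>2" for f h
      using q_ad[of e f h] Q.sym[of f "br e h"] by (auto simp: br_simps Q.q_simps)
    then show ?thesis by (subst sum.swap) simp
  qed
  then show ?thesis by (simp add: A_def)
qed

lemma A_eq_0:
  assumes "\<And>e f h. e \<in> V i \<Longrightarrow> f \<in> V j \<Longrightarrow> h \<in> V l \<Longrightarrow> q (br e f) h = 0"
    and "i \<in> {0..r+s}" "j \<in> {0..r+s}" "l \<in> {0..r+s}"
  shows "A i j l = 0"
  unfolding A_def using assms D.E_in_V by (intro sum.neutral ballI) simp

lemma A_000: "A 0 0 0 = 0"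
  by (rule A_eq_0) (auto simp: V_0 intro: q_kp br_pp)

lemma A_0kk: "i \<in> {1..r+s} \<Longrightarrow> j \<in> {1..r+s} \<Longrightarrow> A i j 0 = 0"
proof (rule A_eq_0)
  fix e f h assume "i \<in> {1..r+s}" "j \<in> {1..r+s}" "e \<in> V i" "f \<in> V j" "h \<in> V 0"
  then show "q (br e f) h = 0"
    using kk_sub_k[of i] kk_sub_k[of j] by (intro q_kp br_kk) (auto simp: V_def)
qed auto

lemma A_kkk:
  assumes "i \<in> {1..r+s}" "j \<in> {1..r+s}" "l \<in> {1..r+s}" "\<not> (i = j \<and> j = l)"
  shows "A i j l = 0"
proof (rule A_eq_0)
  fix e f h assume efh: "e \<in> V i" "f \<in> V j" "h \<in> V l"
  show "q (br e f) h = 0"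
  proof (cases "i = j")
    case True
    then show ?thesis using kk_orth[of i l "br e f" h] kk_closed[of i e f] assms efh by (auto simp: V_def)
  next
    case False
    then have "br e f = 0" using kk_commute[of i j e f] assms efh by (auto simp: V_def)
    then show ?thesis by (simp add: Q.q_simps)
  qed
qed (use assms in auto)

text \<open>Minus the trace of the square of ad X over the summand, that is, minus its own Killing
  form at \<open>X\<close>.\<close>

lemma sum_br_kk:
  assumes i: "i \<in> {1..r+s}" and X: "X \<in> kk i"
  shows "(\<Sum>f\<in>E i. q (br X f) (br X f)) = \<kappa> i * q X X"
proof -
  have on: "Q.onb_on (kk i) (E i)" using D.onb_V[of i] i V_pos by simp
  have Xk: "X \<in> kspace \<theta>" using kk_sub_k i X by blast
  have "killing_on br (kk i) X X = (\<Sum>f\<in>E i. q (br X (br X f)) f)"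
    unfolding killing_on_def
    by (rule Q.trace_on_eq[OF on linear_br_br]) (use kk_closed[OF i] X in auto)
  also have "\<dots> = - (\<Sum>f\<in>E i. q (br X f) (br X f))"
    using q_ad_k[OF Xk] by (simp add: sum_negf)
  finally show ?thesis using kappa i X killing_k[OF Xk, of X] by simp
qed

lemma killing_eq_sum: "killing br X X = (\<Sum>i\<in>{0..r+s}. \<Sum>f\<in>E i. q (br X (br X f)) f)"
  unfolding killing_trace
  using Q.trace_on_eq[of UNIV "\<Union>i\<in>{0..r+s}. E i", OF _ linear_br_br] D.onb_E
  by (simp add: Q.onb_UNIV_iff D.sum_E)

text \<open>The sum over all blocks is \<open>q X X\<close>, since \<open>q\<close> is minus the
  Killing form on k. Other summands of k commute with \<open>X\<close>, so p receives what the block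
  \<open>i\<close> leaves over.\<close>

lemma sum_br_kp:
  assumes i: "i \<in> {1..r+s}" and X: "X \<in> kk i"
  shows "(\<Sum>f\<in>E 0. q (br X f) (br X f)) = (1 - \<kappa> i) * q X X"
proof -
  have Xk: "X \<in> kspace \<theta>" using kk_sub_k i X by blast
  have "(\<Sum>f\<in>E j. q (br X f) (br X f)) = 0" if "j \<in> {1..r+s} - {i}" for j
  proof (rule sum.neutral, rule ballI)
    fix f assume "f \<in> E j"
    then have "f \<in> kk j" using D.E_in_V[of j f] that V_pos[of j] by auto
    then have "br X f = 0" using kk_commute[of i j X f] i X that by auto
    then show "q (br X f) (br X f) = 0" by (simp add: Q.q_simps)
  qed
  then have "(\<Sum>j\<in>{1..r+s}. \<Sum>f\<in>E j. q (br X f) (br X f)) = (\<Sum>f\<in>E i. q (br X f) (br X f))"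
    using i by (subst sum.remove[of _ i]) auto
  moreover have "q X X = (\<Sum>j\<in>{0..r+s}. \<Sum>f\<in>E j. q (br X f) (br X f))"
    using killing_eq_sum[of X] killing_k[OF Xk, of X] q_ad_k[OF Xk] by (simp add: sum_negf)
  ultimately show ?thesis
    using sum_br_kk[OF i X] by (simp add: index_split algebra_simps)
qed

lemma A_iii: assumes i: "i \<in> {1..r+s}" shows "A i i i = real (dim (kk i)) * \<kappa> i"
proof -
  have on: "Q.onb_on (kk i) (E i)" using D.onb_V[of i] i V_pos by simp
  note m = Q.onb_on_mem[OF on]
  have "A i i i = (\<Sum>e\<in>E i. \<Sum>f\<in>E i. q (br e f) (br e f))"
    unfolding A_def
    using Q.onb_parseval[OF on kk_closed[OF i m m]] by (simp add: power2_eq_square)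
  also have "\<dots> = (\<Sum>e\<in>E i. \<kappa> i)"
    using sum_br_kk[OF i m] Q.onb_on_unit[OF on] by simp
  finally show ?thesis using Q.onb_on_card[OF on] by simp
qed

lemma A_i00: assumes i: "i \<in> {1..r+s}" shows "A i 0 0 = real (dim (kk i)) * (1 - \<kappa> i)"
proof -
  have on: "Q.onb_on (kk i) (E i)" using D.onb_V[of i] i V_pos by simp
  have on0: "Q.onb_on (pspace br \<theta>) (E 0)" using D.onb_V[of 0] V_0 by simp
  have "br e f \<in> pspace br \<theta>" if "e \<in> E i" "f \<in> E 0" for e f
    using br_kp kk_sub_k[OF i] Q.onb_on_mem[OF on that(1)] Q.onb_on_mem[OF on0 that(2)] by blast
  then have "A i 0 0 = (\<Sum>e\<in>E i. \<Sum>f\<in>E 0. q (br e f) (br e f))"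
    unfolding A_def
    using Q.onb_parseval[OF on0] by (simp add: power2_eq_square)
  also have "\<dots> = (\<Sum>e\<in>E i. 1 - \<kappa> i)"
    using sum_br_kp[OF i Q.onb_on_mem[OF on]] Q.onb_on_unit[OF on] by simp
  finally show ?thesis using Q.onb_on_card[OF on] by simp
qed

text \<open>The bracket relations between k and p and the commuting of distinct summands of k leave
  only \<open>A i i i\<close> and the three arrangements of \<open>A i 0 0\<close>. An arbitrary
  weight lets the lemma serve both the dimension identity and the scalar curvature.\<close>

lemma sum_A:
  fixes w :: "nat \<Rightarrow> nat \<Rightarrow> nat \<Rightarrow> real"
  shows "(\<Sum>i\<in>{0..r+s}. \<Sum>j\<in>{0..r+s}. \<Sum>l\<in>{0..r+s}. w i j l * A i j l)
    = (\<Sum>i\<in>{1..r+s}. real (dim (kk i)) * (1 - \<kappa> i) * (w 0 0 i + w 0 i 0 + w i 0 0)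
        + real (dim (kk i)) * \<kappa> i * w i i i)"
proof -
  let ?K = "{1..r+s}"
  have A00: "A 0 0 i = A i 0 0" "A 0 i 0 = A i 0 0" for i
    using A_swap23[of 0 0 i] A_swap12[of 0 i 0] by simp_all
  have A0: "A i 0 j = 0" "A 0 i j = 0" if "i \<in> ?K" "j \<in> ?K" for i j
    using A_0kk[OF that] A_swap23[of i j 0] A_swap12[of i 0 j] that by simp_all
  have "(\<Sum>j\<in>?K. \<Sum>l\<in>?K. w i j l * A i j l) = w i i i * A i i i" if i: "i \<in> ?K" for i
  proof -
    have "(\<Sum>l\<in>?K. w i j l * A i j l) = (if j = i then w i i i * A i i i else 0)" if j: "j \<in> ?K" for j
    proof -
      have "(\<Sum>l\<in>?K. w i j l * A i j l) = (\<Sum>l\<in>?K. if l = i then (if j = i then w i i i * A i i i else 0) else 0)"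
        by (intro sum.cong refl) (use A_kkk[OF i j] in auto)
      then show ?thesis using i by simp
    qed
    then have "(\<Sum>j\<in>?K. \<Sum>l\<in>?K. w i j l * A i j l) = (\<Sum>j\<in>?K. if j = i then w i i i * A i i i else 0)"
      by (intro sum.cong refl)
    then show ?thesis using i by simp
  qed
  then have diagonal: "(\<Sum>i\<in>?K. \<Sum>j\<in>?K. \<Sum>l\<in>?K. w i j l * A i j l) = (\<Sum>i\<in>?K. w i i i * A i i i)"
    by (rule sum.cong[OF refl])
  have split: "(\<Sum>i\<in>{0..r+s}. h i) = h 0 + (\<Sum>i\<in>?K. h i)" for h :: "nat \<Rightarrow> real"
    by (simp add: index_split)
  have "(\<Sum>i\<in>{0..r+s}. \<Sum>j\<in>{0..r+s}. \<Sum>l\<in>{0..r+s}. w i j l * A i j l)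
    = w 0 0 0 * A 0 0 0 + (\<Sum>l\<in>?K. w 0 0 l * A 0 0 l) + (\<Sum>j\<in>?K. w 0 j 0 * A 0 j 0)
      + (\<Sum>j\<in>?K. \<Sum>l\<in>?K. w 0 j l * A 0 j l) + (\<Sum>i\<in>?K. w i 0 0 * A i 0 0)
      + (\<Sum>i\<in>?K. \<Sum>l\<in>?K. w i 0 l * A i 0 l) + (\<Sum>i\<in>?K. \<Sum>j\<in>?K. w i j 0 * A i j 0)
      + (\<Sum>i\<in>?K. \<Sum>j\<in>?K. \<Sum>l\<in>?K. w i j l * A i j l)"
    unfolding split sum.distrib by simp
  also have "\<dots> = (\<Sum>l\<in>?K. w 0 0 l * A l 0 0) + (\<Sum>j\<in>?K. w 0 j 0 * A j 0 0)
      + (\<Sum>i\<in>?K. w i 0 0 * A i 0 0) + (\<Sum>i\<in>?K. w i i i * A i i i)"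
  proof -
    have "(\<Sum>j\<in>?K. \<Sum>l\<in>?K. w 0 j l * A 0 j l) = 0" "(\<Sum>i\<in>?K. \<Sum>l\<in>?K. w i 0 l * A i 0 l) = 0"
      "(\<Sum>i\<in>?K. \<Sum>j\<in>?K. w i j 0 * A i j 0) = 0"
      using A_0kk A0 by (intro sum.neutral ballI; simp)+
    moreover have "(\<Sum>l\<in>?K. w 0 0 l * A 0 0 l) = (\<Sum>l\<in>?K. w 0 0 l * A l 0 0)"
      "(\<Sum>j\<in>?K. w 0 j 0 * A 0 j 0) = (\<Sum>j\<in>?K. w 0 j 0 * A j 0 0)"
      by (intro sum.cong refl arg_cong2[where f = times] A00)+
    ultimately show ?thesis unfolding diagonal A_000 by simp
  qed
  also have "\<dots> = (\<Sum>i\<in>?K. real (dim (kk i)) * (1 - \<kappa> i) * (w 0 0 i + w 0 i 0 + w i 0 0)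
        + real (dim (kk i)) * \<kappa> i * w i i i)"
    unfolding sum.distrib[symmetric]
    by (intro sum.cong refl) (simp only: A_i00 A_iii, simp add: algebra_simps)
  finally show ?thesis .
qed

text \<open>A unit vector \<open>e\<close> of p has Killing square 1, and ad e is symmetric, so 1 is
  the sum of all squares \<open>(q (br e f) h)\<^sup>2\<close>. Summing over a basis of p counts
  every \<open>A i 0 0\<close> twice.\<close>

lemma dim_p_eq: "real (dim (pspace br \<theta>)) = 2 * (\<Sum>i\<in>{1..r+s}. real (dim (kk i)) * (1 - \<kappa> i))"
proof -
  have on0: "Q.onb_on (pspace br \<theta>) (E 0)" using D.onb_V[of 0] V_0 by simp
  have onE: "Q.onb_on UNIV (\<Union>i\<in>{0..r+s}. E i)" using D.onb_E by (simp add: Q.onb_UNIV_iff)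
  have "1 = (\<Sum>j\<in>{0..r+s}. \<Sum>f\<in>E j. \<Sum>l\<in>{0..r+s}. \<Sum>h\<in>E l. (q (br e f) h)\<^sup>2)" if e: "e \<in> E 0" for e
  proof -
    have ep: "e \<in> pspace br \<theta>" using Q.onb_on_mem[OF on0 e] .
    have "1 = killing br e e" using killing_p[OF ep, of e] Q.onb_on_unit[OF on0 e] by simp
    also have "\<dots> = (\<Sum>j\<in>{0..r+s}. \<Sum>f\<in>E j. q (br e f) (br e f))"
      unfolding killing_eq_sum
      by (intro sum.cong refl) (simp add: q_ad[of e "br e _"] theta_p[OF ep] br_simps Q.q_simps)
    also have "\<dots> = (\<Sum>j\<in>{0..r+s}. \<Sum>f\<in>E j. \<Sum>l\<in>{0..r+s}. \<Sum>h\<in>E l. (q (br e f) h)\<^sup>2)"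
      by (subst Q.onb_parseval[OF onE UNIV_I]) (simp add: D.sum_E power2_eq_square)
    finally show ?thesis .
  qed
  then have "(\<Sum>e\<in>E 0. 1) = (\<Sum>e\<in>E 0. \<Sum>j\<in>{0..r+s}. \<Sum>f\<in>E j. \<Sum>l\<in>{0..r+s}. \<Sum>h\<in>E l. (q (br e f) h)\<^sup>2)"
    by (rule sum.cong[OF refl])
  also have "\<dots> = (\<Sum>j\<in>{0..r+s}. \<Sum>l\<in>{0..r+s}. A 0 j l)"
    using sum_blocks[where i = 0 and w = "\<lambda>_ _. 1"] by simp
  \<comment> \<open>The indicator weight restricts the first index to p; it admits the arrangements
    (0,0,i) and (0,i,0) but not (i,0,0), whence the factor 2.\<close>
  also have "\<dots> = (\<Sum>i\<in>{0..r+s}. \<Sum>j\<in>{0..r+s}. \<Sum>l\<in>{0..r+s}. (if i = 0 then 1 else 0) * A i j l)"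
    by (simp add: index_split)
  also have "\<dots> = 2 * (\<Sum>i\<in>{1..r+s}. real (dim (kk i)) * (1 - \<kappa> i))"
    unfolding sum_A by (simp add: sum_distrib_left mult_ac)
  finally show ?thesis using Q.onb_on_card[OF on0] by simp
qed

lemma dim_k_eq: "real (dim (kspace \<theta>)) = (\<Sum>i\<in>{1..r+s}. real (dim (kk i)))"
proof -
  have disj: "E i \<inter> E j = {}" if "i \<in> {1..r+s}" "j \<in> {1..r+s}" "i \<noteq> j" for i j
  proof (rule equals0I)
    fix e assume "e \<in> E i \<inter> E j"
    then have "q e e = 0" "q e e = 1"
      using D.orth_V[of i j e e] D.E_in_V[of i e] D.E_in_V[of j e] that
        Q.onb_on_unit[OF D.onb_V[of i], of e] by auto
    then show False by simp
  qed
  let ?E = "\<Union>i\<in>{1..r+s}. E i"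
  have "Q.onb_on (kspace \<theta>) ?E"
    unfolding Q.onb_on_def
  proof (intro conjI ballI impI)
    show "finite ?E" using D.fin_E by auto
    show "q e e = 1" if "e \<in> ?E" for e using that Q.onb_on_unit[OF D.onb_V] by auto
    show "q e f = 0" if ef: "e \<in> ?E" "f \<in> ?E" "e \<noteq> f" for e f
    proof -
      obtain i j where ij: "i \<in> {1..r+s}" "e \<in> E i" "j \<in> {1..r+s}" "f \<in> E j" using ef by blast
      then have ij0: "i \<in> {0..r+s}" "j \<in> {0..r+s}" by auto
      show ?thesis
      proof (cases "i = j")
        case True
        then show ?thesis using Q.onb_on_orth[OF D.onb_V[OF ij0(1)]] ij ef by simp
      next
        case False
        then show ?thesis using D.orth_V[OF ij0] D.E_in_V ij ij0 by blast
      qed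
    qed
    show "span ?E = kspace \<theta>"
    proof
      have "E i \<subseteq> kspace \<theta>" if "i \<in> {1..r+s}" for i
        using D.E_in_V[of i] kk_sub_k[OF that] V_pos[OF that] that by auto
      then show "span ?E \<subseteq> kspace \<theta>" by (intro span_minimal subspace_kspace UN_least)
      show "kspace \<theta> \<subseteq> span ?E"
      proof
        fix X assume X: "X \<in> kspace \<theta>"
        have onE: "Q.onb_on UNIV (\<Union>i\<in>{0..r+s}. E i)" using D.onb_E by (simp add: Q.onb_UNIV_iff)
        have "q X e = 0" if "e \<in> E 0" for e
          using q_kp[OF X] D.E_in_V[of 0 e] that V_0 by simp
        then have "X = (\<Sum>i\<in>{1..r+s}. \<Sum>e\<in>E i. q X e *\<^sub>R e)"
          using Q.onb_expand[OF onE UNIV_I, of X] D.sum_E[of "\<lambda>e. q X e *\<^sub>R e"]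
          by (simp add: index_split)
        also have "\<dots> \<in> span ?E" by (intro span_sum span_scale span_base) auto
        finally show "X \<in> span ?E" .
      qed
    qed
  qed
  then have "dim (kspace \<theta>) = card ?E" using Q.onb_on_card by simp
  also have "\<dots> = (\<Sum>i\<in>{1..r+s}. card (E i))"
    using disj D.fin_E by (intro card_UN_disjoint) auto
  also have "\<dots> = (\<Sum>i\<in>{1..r+s}. dim (kk i))"
    using D.card_E V_pos by (intro sum.cong refl) auto
  finally show ?thesis by simp
qed

section \<open>Consequences of simplicity and non-compactness: bounds on the constants
  \<open>\<kappa> i\<close>\<close>

lemma kspace_proper: "kspace \<theta> \<noteq> UNIV"
proof
  assume k: "kspace \<theta> = UNIV"
  have "killing br X X < 0" if "X \<noteq> 0" for X
    using Q.pos[OF that] killing_k[of X X] k by simp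
  then show False using noncompact by blast
qed

lemma dim_p_pos: "0 < dim (pspace br \<theta>)"
proof (rule ccontr)
  assume "\<not> 0 < dim (pspace br \<theta>)"
  then have "pspace br \<theta> \<subseteq> {0}" by simp
  then have "pproj \<theta> X = 0" for X using pproj_in[of X] by blast
  then have "X \<in> kspace \<theta>" for X using kproj_pproj[of X] kproj_in[of X] by simp
  then show False using kspace_proper by blast
qed

text \<open>The kernel \<open>Z\<close> of the action of k on p is an ideal of the whole algebra: p
  annihilates it, and k preserves it by Jacobi. Being contained in the proper subspace k, it is 0 by
  simplicity.\<close>

lemma kspace_faithful_on_p:
  assumes X: "X \<in> kspace \<theta>" and 0: "\<And>Y. Y \<in> pspace br \<theta> \<Longrightarrow> br X Y = 0"
  shows "X = 0"
proof -
  define Z where "Z = {X \<in> kspace \<theta>. \<forall>Y\<in>pspace br \<theta>. br X Y = 0}"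
  have subZ: "subspace Z"
    using subspace_kspace by (auto simp: Z_def subspace_def br_simps)
  have "br W U \<in> Z" if U: "U \<in> Z" for W U
  proof -
    define a b where "a = kproj \<theta> W" and "b = pproj \<theta> W"
    have a: "a \<in> kspace \<theta>" and b: "b \<in> pspace br \<theta>" and W: "W = a + b"
      using kproj_in pproj_in kproj_pproj[of W] by (simp_all add: a_def b_def)
    have "br U b = 0" using U b by (simp add: Z_def)
    then have "br b U = 0" using br_skew[of b U] by simp
    then have "br W U = br a U" by (simp add: W br_simps)
    moreover have "br a U \<in> Z"
      using U a br_kk[OF a] br_kp[OF a] by (auto simp: Z_def jacobi br_simps)
    ultimately show ?thesis by simp
  qed
  then have "ideal_in br Z UNIV" using subZ by (simp add: ideal_in_def)
  then have "Z = {0} \<or> Z = UNIV" using simple by (simp add: simple_alg_def)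
  moreover have "Z \<noteq> UNIV" using kspace_proper by (auto simp: Z_def)
  moreover have "X \<in> Z" using X 0 by (simp add: Z_def)
  ultimately show ?thesis by blast
qed

lemma exists_nonzero:
  assumes "i \<in> {1..r+s}" obtains X where "X \<in> kk i" "X \<noteq> 0"
  using kk_nonzero[OF assms] subspace_0[OF kk_subspace[OF assms]] by blast

lemma kappa_nonneg: assumes i: "i \<in> {1..r+s}" shows "0 \<le> \<kappa> i"
proof -
  obtain X where X: "X \<in> kk i" "X \<noteq> 0" using exists_nonzero[OF i] .
  have "0 \<le> \<kappa> i * q X X"
    unfolding sum_br_kk[OF i X(1), symmetric] by (intro sum_nonneg Q.q_nonneg)
  then show ?thesis using Q.pos[OF X(2)] by (simp add: zero_le_mult_iff)
qed

lemma kappa_centre: assumes "i \<in> {1..r+s}" "i \<notin> {1..r}" shows "\<kappa> i = 0"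
  using assms(1)
proof (cases rule: index_cases)
  case 2
  obtain X where X: "X \<in> kk i" "X \<noteq> 0" using exists_nonzero[OF assms(1)] .
  have "br X f = 0" if "f \<in> E i" for f
    using D.E_in_V[of i f] V_pos[OF assms(1)] kk_sub_k[OF assms(1)] that assms(1) X(1) 2
    by (auto simp: centre_def)
  then have "\<kappa> i * q X X = 0"
    unfolding sum_br_kk[OF assms(1) X(1), symmetric] by (simp add: Q.q_simps)
  then show ?thesis using Q.pos[OF X(2)] by simp
qed (use assms in simp)

text \<open>\<open>(1 - \<kappa> i) * q X X\<close> is the sum of the squared lengths of
  \<open>br X f\<close> over a basis of p, and these cannot all vanish because k acts faithfully on
  p.\<close>

lemma kappa_less_1: assumes i: "i \<in> {1..r+s}" shows "\<kappa> i < 1"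
proof -
  obtain X where X: "X \<in> kk i" "X \<noteq> 0" using exists_nonzero[OF i] .
  have Xk: "X \<in> kspace \<theta>" using kk_sub_k[OF i] X by blast
  have on0: "Q.onb_on (pspace br \<theta>) (E 0)" using D.onb_V[of 0] V_0 by simp
  have "\<exists>f\<in>E 0. br X f \<noteq> 0"
  proof (rule ccontr)
    assume "\<not> (\<exists>f\<in>E 0. br X f \<noteq> 0)"
    then have "br X Y = 0" if "Y \<in> pspace br \<theta>" for Y
      using Q.onb_expand[OF on0 that]
      by (metis (no_types, lifting) linear_br linear_scale linear_sum scaleR_zero_right sum.neutral)
    then show False using kspace_faithful_on_p[OF Xk] X(2) by blast
  qed
  then obtain f where f: "f \<in> E 0" "br X f \<noteq> 0" by blast
  have "0 < q (br X f) (br X f)" using Q.pos[OF f(2)] .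
  also have "\<dots> \<le> (\<Sum>f\<in>E 0. q (br X f) (br X f))"
    using f(1) D.fin_E[of 0] Q.q_nonneg by (intro member_le_sum) auto
  also have "\<dots> = (1 - \<kappa> i) * q X X" by (rule sum_br_kp[OF i X(1)])
  finally show ?thesis using Q.pos[OF X(2)] by (simp add: zero_less_mult_iff)
qed

lemma killing_E: "i \<in> {0..r+s} \<Longrightarrow> e \<in> E i \<Longrightarrow> killing br e e = (if i = 0 then 1 else - 1)"
  using Q.onb_on_unit[OF D.onb_V, of i e] D.E_in_V[of i e] killing_p[of e e] killing_k[of e e] kk_sub_k[of i]
  by (cases "i = 0") (auto simp: V_def)

theorem scal_diag:
  assumes pos: "\<And>i. i \<in> {0..r+s} \<Longrightarrow> 0 < \<mu> i"
  shows "scal br (D.diag \<mu>) = - real (dim (pspace br \<theta>)) / (2 * \<mu> 0)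
    + (\<Sum>i\<in>{1..r+s}. real (dim (kk i)) * \<kappa> i / (4 * \<mu> i)
         - real (dim (kk i)) * (1 - \<kappa> i) * \<mu> i / (4 * (\<mu> 0)\<^sup>2))"
proof -
  interpret g: inner_form "D.diag \<mu>" by (rule D.inner_form_diag[OF pos])
  interpret m: metric_lie_algebra "D.diag \<mu>" br by unfold_locales (rule lie)
  let ?J = "{0..r+s}" and ?F = "D.scaled_basis \<mu>"
  have scaled: "(\<Sum>e\<in>?F. h e) = (\<Sum>i\<in>?J. \<Sum>e\<in>E i. h ((1 / sqrt (\<mu> i)) *\<^sub>R e))"
    for h :: "'g \<Rightarrow> real" by (rule D.sum_scaled_basis[OF pos])
  have mu0: "0 < \<mu> 0" using pos by simp
  have "(\<Sum>e\<in>?F. \<Sum>f\<in>?F. \<Sum>h\<in>?F. (D.diag \<mu> (br e f) h)\<^sup>2)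
     = (\<Sum>i\<in>?J. \<Sum>e\<in>E i. \<Sum>j\<in>?J. \<Sum>f\<in>E j. \<Sum>l\<in>?J. \<Sum>h\<in>E l. \<mu> l / (\<mu> i * \<mu> j) * (q (br e f) h)\<^sup>2)"
    unfolding scaled
  proof (intro sum.cong refl)
    fix i e j f l h
    assume i: "i \<in> ?J" "e \<in> E i" and j: "j \<in> ?J" "f \<in> E j" and l: "l \<in> ?J" "h \<in> E l"
    \<comment> \<open>Three normalising factors and the coefficient \<open>\<mu> l\<close> of the
      pairing combine, after squaring, to the weight
      \<open>\<mu> l / (\<mu> i * \<mu> j)\<close>.\<close>
    have "D.diag \<mu> (br ((1 / sqrt (\<mu> i)) *\<^sub>R e) ((1 / sqrt (\<mu> j)) *\<^sub>R f)) ((1 / sqrt (\<mu> l)) *\<^sub>R h)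
       = (1 / sqrt (\<mu> l)) * ((1 / sqrt (\<mu> i)) * ((1 / sqrt (\<mu> j)) * (\<mu> l * q (br e f) h)))"
      by (simp add: br_simps g.q_simps D.diag_basis[OF l] Q.q_simps)
    then show "(D.diag \<mu> (br ((1 / sqrt (\<mu> i)) *\<^sub>R e) ((1 / sqrt (\<mu> j)) *\<^sub>R f)) ((1 / sqrt (\<mu> l)) *\<^sub>R h))\<^sup>2
       = \<mu> l / (\<mu> i * \<mu> j) * (q (br e f) h)\<^sup>2"
      using pos[OF i(1)] pos[OF j(1)] pos[OF l(1)]
      by (simp add: power_mult_distrib power_divide) (simp add: power2_eq_square field_simps)
  qed
  also have "\<dots> = (\<Sum>i\<in>?J. \<Sum>j\<in>?J. \<Sum>l\<in>?J. \<mu> l / (\<mu> i * \<mu> j) * A i j l)"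
    by (intro sum.cong refl sum_blocks)
  also have "\<dots> = (\<Sum>i\<in>{1..r+s}. real (dim (kk i)) * (1 - \<kappa> i)
        * (\<mu> i / (\<mu> 0)\<^sup>2 + 2 / \<mu> i) + real (dim (kk i)) * \<kappa> i / \<mu> i)"
    unfolding sum_A
  proof (intro sum.cong refl)
    fix i assume "i \<in> {1..r+s}"
    then have "0 < \<mu> i" using pos by simp
    then show "real (dim (kk i)) * (1 - \<kappa> i) *
          (\<mu> i / (\<mu> 0 * \<mu> 0) + \<mu> 0 / (\<mu> 0 * \<mu> i) + \<mu> 0 / (\<mu> i * \<mu> 0)) +
          real (dim (kk i)) * \<kappa> i * (\<mu> i / (\<mu> i * \<mu> i)) =
         real (dim (kk i)) * (1 - \<kappa> i) * (\<mu> i / (\<mu> 0)\<^sup>2 + 2 / \<mu> i) + real (dim (kk i)) * \<kappa> i / \<mu> i"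
      using mu0 by (simp add: power2_eq_square)
  qed
  finally have P: "(\<Sum>e\<in>?F. \<Sum>f\<in>?F. \<Sum>h\<in>?F. (D.diag \<mu> (br e f) h)\<^sup>2) = \<dots>" .
  have "(\<Sum>e\<in>?F. killing br e e) = (\<Sum>i\<in>?J. \<Sum>e\<in>E i. (if i = 0 then 1 else - 1) / \<mu> i)"
    unfolding scaled
  proof (intro sum.cong refl)
    fix i e assume i: "i \<in> ?J" "e \<in> E i"
    show "killing br ((1 / sqrt (\<mu> i)) *\<^sub>R e) ((1 / sqrt (\<mu> i)) *\<^sub>R e) = (if i = 0 then 1 else - 1) / \<mu> i"
      using pos[OF i(1)] by (simp add: killing_simps killing_E[OF i])
  qed
  also have "\<dots> = (\<Sum>i\<in>?J. real (dim (V i)) * ((if i = 0 then 1 else - 1) / \<mu> i))"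
    by (simp add: D.card_E cong: sum.cong_simp)
  also have "\<dots> = real (dim (pspace br \<theta>)) / \<mu> 0 - (\<Sum>i\<in>{1..r+s}. real (dim (kk i)) / \<mu> i)"
    by (simp add: index_split V_def sum_negf cong: sum.cong_simp)
  finally have K: "(\<Sum>e\<in>?F. killing br e e) = \<dots>" .
  \<comment> \<open>The Killing form has sign -1 on k, so its trace contributes
    \<open>d / (2 * \<mu> i)\<close>, \<open>d\<close> being the dimension of \<open>kk i\<close>.
    Against \<open>- (2 * d * (1 - \<kappa> i) + d * \<kappa> i) / (4 * \<mu> i)\<close> from the
    squares this leaves \<open>d * \<kappa> i / (4 * \<mu> i)\<close>.\<close>
  have "(\<Sum>i\<in>{1..r+s}. real (dim (kk i)) * \<kappa> i / (4 * \<mu> i)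
         - real (dim (kk i)) * (1 - \<kappa> i) * \<mu> i / (4 * (\<mu> 0)\<^sup>2))
    = - (\<Sum>i\<in>{1..r+s}. real (dim (kk i)) * (1 - \<kappa> i)
        * (\<mu> i / (\<mu> 0)\<^sup>2 + 2 / \<mu> i) + real (dim (kk i)) * \<kappa> i / \<mu> i) / 4
      + (\<Sum>i\<in>{1..r+s}. real (dim (kk i)) / \<mu> i) / 2"
    unfolding sum_negf[symmetric] sum_divide_distrib sum.distrib[symmetric]
  proof (intro sum.cong refl)
    fix i assume "i \<in> {1..r+s}"
    then have "0 < \<mu> i" using pos by simp
    then show "real (dim (kk i)) * \<kappa> i / (4 * \<mu> i)
         - real (dim (kk i)) * (1 - \<kappa> i) * \<mu> i / (4 * (\<mu> 0)\<^sup>2)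
       = - (real (dim (kk i)) * (1 - \<kappa> i) * (\<mu> i / (\<mu> 0)\<^sup>2 + 2 / \<mu> i) + real (dim (kk i)) * \<kappa> i / \<mu> i) / 4
         + real (dim (kk i)) / \<mu> i / 2"
      using mu0 by (simp add: divide_simps) (simp add: algebra_simps)
  qed
  moreover have "onb (D.diag \<mu>) ?F" by (rule D.onb_scaled_basis[OF pos])
  note m.scal_unimodular[OF this trace_ad, unfolded P K]
  ultimately show ?thesis by (simp add: diff_divide_distrib mult.commute)
qed

lemma diag_eq_sum:
  "D.diag \<mu> = (\<lambda>X Y. \<mu> 0 * Qres q (pspace br \<theta>) X Y + (\<Sum>i\<in>{1..r+s}. \<mu> i * Qres q (kk i) X Y))"
  unfolding D.diag_def by (intro ext) (simp add: index_split V_def cong: sum.cong_simp)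

lemma MK_eq: "MK br \<theta> kk (r+s) = {D.diag \<mu> |\<mu>. \<forall>i\<in>{0..r+s}. 0 < \<mu> i}"
proof (intro set_eqI iffI)
  fix g assume "g \<in> MK br \<theta> kk (r+s)"
  then obtain \<beta> \<alpha> where ba: "\<beta> > 0" "\<forall>i\<in>{1..r+s}. \<alpha> i > 0"
    and g: "g = (\<lambda>X Y. \<beta> * Qres q (pspace br \<theta>) X Y + (\<Sum>i\<in>{1..r+s}. \<alpha> i * Qres q (kk i) X Y))"
    unfolding MK_def by blast
  have "g = D.diag (\<alpha>(0 := \<beta>))" unfolding g diag_eq_sum by (simp cong: sum.cong_simp)
  moreover have "\<forall>i\<in>{0..r+s}. 0 < (\<alpha>(0 := \<beta>)) i" using ba by auto
  ultimately show "g \<in> {D.diag \<mu> |\<mu>. \<forall>i\<in>{0..r+s}. 0 < \<mu> i}" by blast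
next
  fix g assume "g \<in> {D.diag \<mu> |\<mu>. \<forall>i\<in>{0..r+s}. 0 < \<mu> i}"
  then obtain \<mu> where mu: "\<forall>i\<in>{0..r+s}. 0 < \<mu> i" and g: "g = D.diag \<mu>" by blast
  show "g \<in> MK br \<theta> kk (r+s)"
    unfolding MK_def g diag_eq_sum
    by (rule CollectI, rule exI[of _ "\<mu> 0"], rule exI[of _ \<mu>]) (use mu in auto)
qed

lemma tr_form_diag:
  assumes pos: "\<And>i. i \<in> {0..r+s} \<Longrightarrow> 0 < \<mu> i"
  shows "tr_form (D.diag \<mu>) (D.diag \<tau>)
    = real (dim (pspace br \<theta>)) * \<tau> 0 / \<mu> 0 + (\<Sum>i\<in>{1..r+s}. real (dim (kk i)) * \<tau> i / \<mu> i)"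
proof -
  have "tr_form (D.diag \<mu>) (D.diag \<tau>) = (\<Sum>i\<in>{0..r+s}. real (dim (V i)) * \<tau> i / \<mu> i)"
    by (rule D.tr_form_diag[OF pos])
  also have "\<dots> = real (dim (V 0)) * \<tau> 0 / \<mu> 0 + (\<Sum>i\<in>{1..r+s}. real (dim (V i)) * \<tau> i / \<mu> i)"
    by (simp add: index_split)
  finally show ?thesis by (simp add: V_def)
qed

end

section \<open>Transfer of the optimum back to the left-invariant metrics\<close>

theorem theorem5p3:
  fixes br :: "'g::euclidean_space \<Rightarrow> 'g \<Rightarrow> 'g"
    and \<theta> :: "'g \<Rightarrow> 'g"
    and kk :: "nat \<Rightarrow> 'g set"
    and r s m :: nat
    and \<kappa> :: "nat \<Rightarrow> real"
    and Tp :: real and Ti :: "nat \<Rightarrow> real"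
    and T :: "'g \<Rightarrow> 'g \<Rightarrow> real"
  assumes lie: "lie_bracket br"
    and simple: "simple_alg br UNIV"
    and noncompact: "\<not> (\<forall>X. X \<noteq> 0 \<longrightarrow> killing br X X < 0)"
    and cartan: "cartan_involution br \<theta>"
    and s_def: "s = (if centre br (kspace \<theta>) = {0} then 0 else 1)"
    and kk_simple: "\<forall>i\<in>{1..r}. simple_alg br (kk i) \<and> ideal_in br (kk i) (derived br (kspace \<theta>))"
    and kk_disj: "\<forall>i\<in>{1..r}. \<forall>j\<in>{1..r}. i \<noteq> j \<longrightarrow> kk i \<inter> kk j = {0}"
    and kk_span: "span (\<Union>i\<in>{1..r}. kk i) = derived br (kspace \<theta>)"
    and kk_centre: "s = 1 \<longrightarrow> kk (r + 1) = centre br (kspace \<theta>)"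
    and kappa: "\<forall>i\<in>{1..r+s}. \<forall>X\<in>kk i. \<forall>Y\<in>kk i.
                   killing_on br (kk i) X Y = \<kappa> i * killing br X Y"
    and Tp_pos: "Tp > 0"
    and Ti_pos: "\<forall>i\<in>{1..r+s}. Ti i > 0"
    and T_def: "T = (\<lambda>X Y. - Tp * Qres (Qform br \<theta>) (pspace br \<theta>) X Y
                         + (\<Sum>i\<in>{1..r+s}. Ti i * Qres (Qform br \<theta>) (kk i) X Y))"
    and m_range: "m \<in> {1..r}"
    and m_max: "\<forall>i\<in>{1..r}. \<kappa> i / Ti i \<le> \<kappa> m / Ti m"
    and cond1: "\<kappa> m * tr_form (Qform br \<theta>) T / Ti m
                < real (dim (kspace \<theta>)) + real (dim (kk m)) * (1 - \<kappa> m)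
                  - 3 * real (dim (pspace br \<theta>))"
    and cond2: "(\<Sum>i\<in>{1..r+s}.
                   (real (dim (pspace br \<theta>))^2 * \<kappa> i * Tp^2 - real (dim (kk i))^2 * (1 - \<kappa> i) * (Ti i)^2)
                   / (real (dim (pspace br \<theta>)) * Tp * Ti i))
                - 2 * real (dim (pspace br \<theta>)) < 0"
  shows "\<exists>g0\<in>{g \<in> MK br \<theta> kk (r+s). tr_form g T = 1}.
           \<forall>g\<in>{g \<in> MK br \<theta> kk (r+s). tr_form g T = 1}. scal br g \<le> scal br g0"
proof -
  interpret S: simple_cartan_decomposition br \<theta> kk r s \<kappa>
    by unfold_locales (fact assms)+
  let ?J = "{0..r+s}" and ?K = "{1..r+s}"
  let ?n = "real (dim (pspace br \<theta>))" and ?d = "\<lambda>i. real (dim (kk i))"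
  \<comment> \<open>The negative entry at index 0 produces the term
    \<open>- n * Tp / \<beta>\<close> of the trace constraint.\<close>
  define \<tau> where "\<tau> = Ti(0 := - Tp)"
  have T: "T = S.D.diag \<tau>"
    unfolding S.diag_eq_sum T_def \<tau>_def by (simp cong: sum.cong_simp)
  have tr: "tr_form (S.D.diag \<mu>) T = - ?n * Tp / \<mu> 0 + (\<Sum>i\<in>?K. ?d i * Ti i / \<mu> i)"
    if "\<forall>i\<in>?J. 0 < \<mu> i" for \<mu>
    unfolding T using S.tr_form_diag[of \<mu> \<tau>] that by (simp add: \<tau>_def cong: sum.cong_simp)
  have trQ: "tr_form (Qform br \<theta>) T = (\<Sum>i\<in>?K. ?d i * Ti i) - ?n * Tp"
    using tr[of "\<lambda>_. 1"] by (simp add: S.D.diag_one)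
  have d_pos: "0 < ?d i" if "i \<in> ?K" for i
  proof -
    obtain X where "X \<in> kk i" "X \<noteq> 0" using S.exists_nonzero[OF \<open>i \<in> ?K\<close>] .
    then have "\<not> kk i \<subseteq> {0}" by blast
    then show ?thesis by (metis dim_eq_0 gr0I of_nat_0_less_iff)
  qed
  interpret O: scal_functional ?K ?d \<kappa> Ti ?n Tp m
  proof
    show "0 < ?n" using S.dim_p_pos by simp
    show "?n = 2 * (\<Sum>i\<in>?K. ?d i * (1 - \<kappa> i))" by (rule S.dim_p_eq)
    \<comment> \<open>The hypothesis compares only simple ideals; on the centre
      \<open>\<kappa> i = 0\<close>, so the comparison extends by nonnegativity of
      \<open>\<kappa> m / Ti m\<close>.\<close>
    show "\<kappa> i / Ti i \<le> \<kappa> m / Ti m" if "i \<in> ?K" for i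
    proof (cases "i \<in> {1..r}")
      case False
      have "m \<in> ?K" using m_range by auto
      then have "0 \<le> \<kappa> m / Ti m" using S.kappa_nonneg Ti_pos by (simp add: less_imp_le)
      then show ?thesis using S.kappa_centre[OF that False] by simp
    qed (use m_max in blast)
    show "\<kappa> m * ((\<Sum>i\<in>?K. ?d i * Ti i) - ?n * Tp) / Ti m < (\<Sum>i\<in>?K. ?d i) + ?d m * (1 - \<kappa> m) - 3 * ?n"
      using cond1 unfolding trQ S.dim_k_eq .
  qed (use m_range d_pos S.kappa_nonneg S.kappa_less_1 Ti_pos Tp_pos cond2 in auto)
  define F where "F \<beta> \<alpha> = - ?n / (2 * \<beta>)
      + (\<Sum>i\<in>?K. ?d i * \<kappa> i / (4 * \<alpha> i) - ?d i * (1 - \<kappa> i) * \<alpha> i / (4 * \<beta>\<^sup>2))" for \<beta> \<alpha>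
  define C where "C \<beta> \<alpha> \<longleftrightarrow> 0 < \<beta> \<and> (\<forall>i\<in>?K. 0 < \<alpha> i)
      \<and> - ?n * Tp / \<beta> + (\<Sum>i\<in>?K. ?d i * Ti i / \<alpha> i) = 1" for \<beta> and \<alpha> :: "nat \<Rightarrow> real"
  obtain \<beta> \<alpha> where max: "C \<beta> \<alpha>" "\<And>\<beta>' \<alpha>'. C \<beta>' \<alpha>' \<Longrightarrow> F \<beta>' \<alpha>' \<le> F \<beta> \<alpha>"
    using O.scal_attains_max unfolding F_def C_def by blast
  have pos_iff: "(\<forall>i\<in>?J. 0 < \<mu> i) \<longleftrightarrow> 0 < \<mu> 0 \<and> (\<forall>i\<in>?K. 0 < \<mu> i)" for \<mu> :: "nat \<Rightarrow> real"
    unfolding S.index_split by blast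
  have scal: "scal br (S.D.diag \<mu>) = F (\<mu> 0) \<mu>" if "\<forall>i\<in>?J. 0 < \<mu> i" for \<mu>
    unfolding F_def by (rule S.scal_diag) (use that in blast)
  \<comment> \<open>\<open>C\<close> and \<open>F\<close> read \<open>\<alpha>\<close> only at
    indices from 1 on, so slot 0 is free to carry \<open>\<beta>\<close>.\<close>
  define \<mu> where "\<mu> = \<alpha>(0 := \<beta>)"
  have mu: "C (\<mu> 0) \<mu>" "F (\<mu> 0) \<mu> = F \<beta> \<alpha>"
    using max(1) by (simp_all add: \<mu>_def C_def F_def cong: sum.cong_simp)
  then have mu_pos: "\<forall>i\<in>?J. 0 < \<mu> i" unfolding pos_iff C_def by blast
  show ?thesis
  proof (intro bexI[of _ "S.D.diag \<mu>"] ballI)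
    have "tr_form (S.D.diag \<mu>) T = 1" using tr[OF mu_pos] mu(1) by (simp add: C_def)
    then show "S.D.diag \<mu> \<in> {g \<in> MK br \<theta> kk (r+s). tr_form g T = 1}"
      unfolding S.MK_eq using mu_pos by blast
  next
    fix g assume "g \<in> {g \<in> MK br \<theta> kk (r+s). tr_form g T = 1}"
    then obtain \<nu> where nu: "\<forall>i\<in>?J. 0 < \<nu> i" "g = S.D.diag \<nu>" "tr_form g T = 1"
      unfolding S.MK_eq by blast
    then have "C (\<nu> 0) \<nu>" using tr[OF nu(1)] pos_iff by (simp add: C_def)
    then show "scal br g \<le> scal br (S.D.diag \<mu>)"
      unfolding nu(2) scal[OF nu(1)] scal[OF mu_pos] mu(2) by (rule max(2))
  qed
qed

end
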